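(* Let $k$ be an odd natural number, $\alpha>0$, and let $v_\pm,u_\pm$ be real constants with $v_\pm>0$. Suppose $u_->u_+$. For $\varepsilon>0$ let $(\widehat v^\varepsilon(x,t),\widehat u^\varepsilon(x,t))$ be the similarity solution of $$\begin{cases}\widehat v_t+e^{-\alpha kt}(\widehat v\widehat u^k)_x=0,\\ (\widehat v\widehat u)_t+e^{-\alpha kt}(\widehat v\widehat u^{k+1})_x=\varepsilon\frac{1}{\alpha k}e^{-\alpha kt}(1-e^{-\alpha kt})\widehat u_{xx},\end{cases}\qquad (\widehat v(x,0),\widehat u(x,0))=\begin{cases}(v_-,u_-),&x<0,\\(v_+,u_+),&x>0.\end{cases}$$ Then the limit $$\lim_{\varepsilon\to0+}(\widehat v^\varepsilon(x,t),\widehat u^\varepsilon(x,t))=(\widehat v(x,t),\widehat u(x,t))$$ exists in the measure sense and $(\widehat v,\widehat u)$ solves $$\begin{cases}\widehat v_t+e^{-\alpha kt}(\widehat v\widehat u^k)_x=0,\\ (\widehat v\widehat u)_t+e^{-\alpha kt}(\widehat v\widehat u^{k+1})_x=0\end{cases}$$ with the same initial data. Moreover, with $x(t)=\frac{\sigma}{\alpha k}(1-e^{-\alpha kt})$, $$(\widehat v(x,t),\widehat u(x,t))=\begin{cases}(v_-,u_-),& x<x(t),\\ \left(\frac{w_0}{\alpha k}(1-e^{-\alpha kt})\,\delta(x-x(t)),\,u_\delta\right),& x=x(t),\\ (v_+,u_+),& x>x(t),\end{cases}$$ where the constants $\sigma,w_0,u_\delta$ are determined uniquely by the entropy condition $u_+^k<\sigma<u_-^k$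 and $$\begin{cases}\sigma=u_\delta^k,\\ w_0=-\sigma(v_--v_+)+(v_-u_-^k-v_+u_+^k),\\ w_0u_\delta=-\sigma(v_-u_--v_+u_+)+(v_-u_-^{k+1}-v_+u_+^{k+1}).\end{cases}$$
   Context: Similarity solution: $\widehat v^\varepsilon(x,t)=\widehat v^\varepsilon(\xi)$, $\widehat u^\varepsilon(x,t)=\widehat u^\varepsilon(\xi)$ with $\xi=\frac{\alpha kx}{1-e^{-\alpha kt}}$, $t>0$, where $(\widehat v^\varepsilon(\xi),\widehat u^\varepsilon(\xi))$ is a solution of $$-\xi\widehat v_\xi+(\widehat v\widehat u^k)_\xi=0,\qquad -\xi(\widehat v\widehat u)_\xi+(\widehat v\widehat u^{k+1})_\xi=\varepsilon\widehat u_{\xi\xi},\qquad (\widehat v(\pm\infty),\widehat u(\pm\infty))=(v_\pm,u_\pm)$$ of the following kind: $\widehat u^\varepsilon\in C^2(\mathbb{R})$ is decreasing with $\widehat u^\varepsilon(\pm\infty)=u_\pm$; $\xi_\sigma^\varepsilon$ is the unique point with $(\widehat u^\varepsilon(\xi_\sigma^\varepsilon))^k=\xi_\sigma^\varepsilon$; $$\widehat v^\varepsilon(\xi)=v_-\exp\Big(-\int_{-\infty}^\xi\frac{((\widehat u^\varepsilon(s))^k)'}{(\widehat u^\varepsilon(s))^k-s}ds\Big)\ (\xi<\xi_\sigma^\varepsilon),\qquad \widehat v^\varepsilon(\xi)=v_+\exp\Big(\int_\xi^{+\infty}\frac{((\widehat u^\varepsilon(s))^k)'}{(\widehat u^\varepsilon(s))^k-s}ds\Big)\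 (\xi>\xi_\sigma^\varepsilon);$$ $\widehat v^\varepsilon\in L^1_{loc}(\mathbb{R})$; and $\varepsilon(\widehat u^\varepsilon)''=\widehat v^\varepsilon((\widehat u^\varepsilon)^k-\xi)(\widehat u^\varepsilon)'$ on $\mathbb{R}$ (the product $\widehat v^\varepsilon((\widehat u^\varepsilon)^k-\xi)$ being extended by its limit $0$ at $\xi_\sigma^\varepsilon$). Convergence in the measure sense: $\widehat u^\varepsilon\to u_\mp$ pointwise for $x<x(t)$, respectively $x>x(t)$; $\widehat u^\varepsilon(\xi^\varepsilon_\sigma)\to u_\delta$ (the value of $\widehat u$ on the curve); and $\widehat v^\varepsilon$ converges in the sense of distributions to the sum of the step function equal to $v_-$ for $x<x(t)$ and $v_+$ for $x>x(t)$ and the Dirac measure of weight $w(t)=\frac{w_0}{\alpha k}(1-e^{-\alpha kt})$ supported on $x=x(t)$. Solutions of the limit system are understood in the sense of distributions: for all $\varphi\in C_0^\infty(\mathbb{R}\times(0,\infty))$, $\langle\widehat v,\varphi_t\rangle+\langle\widehat v\widehat u^k,e^{-\alpha kt}\varphi_x\rangle=0$ and $\langle\widehat v\widehat u,\varphi_t\rangle+\langle\widehat v\widehat u^{k+1},e^{-\alpha kt}\varphi_x\rangle=0$, where $\langle\widehat vG(\widehat u),\varphi\rangle=\int_0^\infty\int_{\mathbb{R}}\widetilde vG(\widetilde u)\varphi\,dx\,dt+\int_0^\infty w(t)G(u_\delta)\varphi(x(t),t)\,dt$, with $\widetilde v,\widetilde u$ the step functions given off the curve; the initial data are attained in the sense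 of distributions as $t\to0+$. *)

theory Defs
  imports "HOL-Analysis.Analysis"
begin

subsection \<open>Test functions\<close>

primrec iterated_derivative ::
  "'a::euclidean_space list \<Rightarrow> ('a \<Rightarrow> real) \<Rightarrow> 'a \<Rightarrow> real" where
  "iterated_derivative [] f = f"
| "iterated_derivative (h # hs) f =
     (\<lambda>z. frechet_derivative (iterated_derivative hs f) (at z) h)"

text \<open>Differentiability of every iterated directional derivative forces all of them to be
  continuous, so the following is the usual class of smooth functions.\<close>

definition smooth :: "('a::euclidean_space \<Rightarrow> real) \<Rightarrow> bool" where
  "smooth f \<longleftrightarrow> (\<forall>hs z. iterated_derivative hs f differentiable (at z))"

definition test_function :: "'a::euclidean_space set \<Rightarrow> ('a \<Rightarrow> real) \<Rightarrow> bool" where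
  "test_function \<Omega> \<phi> \<longleftrightarrow> smooth \<phi> \<and>
     compact (closure {z. \<phi> z \<noteq> 0}) \<and> closure {z. \<phi> z \<noteq> 0} \<subseteq> \<Omega>"

text \<open>Points of space-time are pairs \<open>(x, t)\<close>.\<close>

definition half_plane :: "(real \<times> real) set" where
  "half_plane = UNIV \<times> {0<..}"

definition deriv_x :: "(real \<times> real \<Rightarrow> real) \<Rightarrow> real \<times> real \<Rightarrow> real" where
  "deriv_x \<phi> = (\<lambda>(x, t). deriv (\<lambda>y. \<phi> (y, t)) x)"

definition deriv_t :: "(real \<times> real \<Rightarrow> real) \<Rightarrow> real \<times> real \<Rightarrow> real" where
  "deriv_t \<phi> = (\<lambda>(x, t). deriv (\<lambda>s. \<phi> (x, s)) t)"

definition riemann_data :: "real \<Rightarrow> real \<Rightarrow> real \<Rightarrow> real" where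
  "riemann_data l r x = (if x < 0 then l else r)"

subsection \<open>Similarity solutions of the viscous system\<close>

definition C2 :: "(real \<Rightarrow> real) \<Rightarrow> bool" where
  "C2 f \<longleftrightarrow> (\<forall>x. f differentiable (at x)) \<and> (\<forall>x. deriv f differentiable (at x)) \<and>
     continuous_on UNIV (deriv (deriv f))"

definition locally_L1 :: "(real \<Rightarrow> real) \<Rightarrow> bool" where
  "locally_L1 f \<longleftrightarrow> (\<forall>K. compact K \<longrightarrow> set_integrable lborel K f)"

text \<open>The point \<open>\<xi>\<^sub>\<sigma>\<close>; used for profiles for which it exists and is unique.\<close>

definition xi_sigma :: "nat \<Rightarrow> (real \<Rightarrow> real) \<Rightarrow> real" where
  "xi_sigma k u = (THE \<xi>. u \<xi> ^ k = \<xi>)"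

text \<open>
  The profile system
  \<open>- \<xi> v\<^sub>\<xi> + (v u\<^sup>k)\<^sub>\<xi> = 0\<close>, \<open>- \<xi> (v u)\<^sub>\<xi> + (v u\<^sup>k\<^sup>+\<^sup>1)\<^sub>\<xi> = \<epsilon> u\<^sub>\<xi>\<^sub>\<xi>\<close>
  on the whole line, in the sense of distributions because \<open>v\<close> may be singular at \<open>\<xi>\<^sub>\<sigma>\<close>:
  all derivatives are moved to the test function, and
  \<open>- \<xi> f\<^sub>\<xi>\<close> tested with \<open>\<psi>\<close> is \<open>f\<close> tested with \<open>(\<xi> \<psi>)\<^sub>\<xi>\<close>.\<close>

definition solves_profile_system ::
  "nat \<Rightarrow> real \<Rightarrow> (real \<Rightarrow> real) \<Rightarrow> (real \<Rightarrow> real) \<Rightarrow> bool" where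
  "solves_profile_system k \<epsilon> v u \<longleftrightarrow> (\<forall>\<psi>. test_function UNIV \<psi> \<longrightarrow>
     (LBINT \<xi>. v \<xi> * deriv (\<lambda>\<eta>. \<eta> * \<psi> \<eta>) \<xi>) - (LBINT \<xi>. v \<xi> * u \<xi> ^ k * deriv \<psi> \<xi>) = 0 \<and>
     (LBINT \<xi>. v \<xi> * u \<xi> * deriv (\<lambda>\<eta>. \<eta> * \<psi> \<eta>) \<xi>)
       - (LBINT \<xi>. v \<xi> * u \<xi> ^ (k + 1) * deriv \<psi> \<xi>)
       = \<epsilon> * (LBINT \<xi>. u \<xi> * deriv (deriv \<psi>) \<xi>))"

text \<open>
  The value of \<open>v\<close> at \<open>\<xi>\<^sub>\<sigma>\<close> is left free. The product \<open>v (u\<^sup>k - \<xi>)\<close> is \<open>0\<close> there whatever this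
  value is, so the last clause needs no separate convention at that point.\<close>

definition similarity_profile ::
  "nat \<Rightarrow> real \<Rightarrow> real \<Rightarrow> real \<Rightarrow> real \<Rightarrow> real \<Rightarrow> (real \<Rightarrow> real) \<Rightarrow> (real \<Rightarrow> real) \<Rightarrow> bool" where
  "similarity_profile k \<epsilon> vm um vp up v u \<longleftrightarrow>
     solves_profile_system k \<epsilon> v u \<and>
     (v \<longlongrightarrow> vm) at_bot \<and> (v \<longlongrightarrow> vp) at_top \<and>
     (u \<longlongrightarrow> um) at_bot \<and> (u \<longlongrightarrow> up) at_top \<and>
     C2 u \<and> antimono u \<and>
     (\<exists>!\<xi>. u \<xi> ^ k = \<xi>) \<and>
     (\<forall>\<xi> < xi_sigma k u. v \<xi> =
        vm * exp (- (LBINT s=-\<infinity>..ereal \<xi>. deriv (\<lambda>r. u r ^ k) s / (u s ^ k - s)))) \<and>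
     (\<forall>\<xi> > xi_sigma k u. v \<xi> =
        vp * exp (LBINT s=ereal \<xi>..\<infinity>. deriv (\<lambda>r. u r ^ k) s / (u s ^ k - s))) \<and>
     locally_L1 v \<and>
     ((\<lambda>\<xi>. v \<xi> * (u \<xi> ^ k - \<xi>)) \<longlongrightarrow> 0) (at (xi_sigma k u)) \<and>
     (\<forall>\<xi>. \<epsilon> * deriv (deriv u) \<xi> = v \<xi> * (u \<xi> ^ k - \<xi>) * deriv u \<xi>)"

definition similarity_variable :: "real \<Rightarrow> nat \<Rightarrow> real \<Rightarrow> real \<Rightarrow> real" where
  "similarity_variable \<alpha> k x t = \<alpha> * real k * x / (1 - exp (- \<alpha> * real k * t))"

text \<open>
  With \<open>f\<close> the components of a profile for \<open>\<epsilon>\<close>, the functions of \<open>(x, t)\<close>, \<open>t > 0\<close>, below are the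
  similarity solution of
  \<open>v\<^sub>t + e\<^sup>-\<^sup>\<alpha>\<^sup>k\<^sup>t (v u\<^sup>k)\<^sub>x = 0\<close>,
  \<open>(v u)\<^sub>t + e\<^sup>-\<^sup>\<alpha>\<^sup>k\<^sup>t (v u\<^sup>k\<^sup>+\<^sup>1)\<^sub>x = \<epsilon> (\<alpha>k)\<^sup>-\<^sup>1 e\<^sup>-\<^sup>\<alpha>\<^sup>k\<^sup>t (1 - e\<^sup>-\<^sup>\<alpha>\<^sup>k\<^sup>t) u\<^sub>x\<^sub>x\<close>;
  the Riemann data become the values of the profile at \<open>\<plusminus>\<infinity>\<close>, since \<open>\<xi> \<rightarrow> \<plusminus>\<infinity>\<close> as
  \<open>t \<rightarrow> 0+\<close> for \<open>\<plusminus>x > 0\<close>.\<close>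

definition similarity_solution :: "real \<Rightarrow> nat \<Rightarrow> (real \<Rightarrow> real) \<Rightarrow> real \<Rightarrow> real \<Rightarrow> real" where
  "similarity_solution \<alpha> k f x t = f (similarity_variable \<alpha> k x t)"

subsection \<open>Delta waves\<close>

text \<open>
  The pair \<open>(v, u)\<close> in which \<open>v\<close> is the function \<open>regular\<close> plus the Dirac measure of weight
  \<open>weight t\<close> on \<open>x = curve t\<close>, and \<open>u\<close> is the function \<open>velocity\<close>. The value of \<open>velocity\<close>
  on the curve matters: it is the density of \<open>u\<close> against the Dirac part.\<close>

record delta_wave =
  regular :: "real \<Rightarrow> real \<Rightarrow> real"
  velocity :: "real \<Rightarrow> real \<Rightarrow> real"
  curve :: "real \<Rightarrow> real"
  weight :: "real \<Rightarrow> real"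

text \<open>The distribution \<open>v G(u)\<close> on the half plane.\<close>

definition pairing ::
  "delta_wave \<Rightarrow> (real \<Rightarrow> real) \<Rightarrow> (real \<times> real \<Rightarrow> real) \<Rightarrow> real" where
  "pairing W G \<phi> =
     (LBINT t:{0<..}. (LBINT x. regular W x t * G (velocity W x t) * \<phi> (x, t))) +
     (LBINT t:{0<..}. weight W t * G (velocity W (curve W t) t) * \<phi> (curve W t, t))"

definition solves_limit_system :: "real \<Rightarrow> nat \<Rightarrow> delta_wave \<Rightarrow> bool" where
  "solves_limit_system \<alpha> k W \<longleftrightarrow> (\<forall>\<phi>. test_function half_plane \<phi> \<longrightarrow>
     pairing W (\<lambda>_. 1) (deriv_t \<phi>)
       + pairing W (\<lambda>u. u ^ k) (\<lambda>(x, t). exp (- \<alpha> * real k * t) * deriv_x \<phi> (x, t)) = 0 \<and>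
     pairing W (\<lambda>u. u) (deriv_t \<phi>)
       + pairing W (\<lambda>u. u ^ (k + 1)) (\<lambda>(x, t). exp (- \<alpha> * real k * t) * deriv_x \<phi> (x, t)) = 0)"

definition attains_initial_data ::
  "delta_wave \<Rightarrow> (real \<Rightarrow> real) \<Rightarrow> (real \<Rightarrow> real) \<Rightarrow> bool" where
  "attains_initial_data W v0 u0 \<longleftrightarrow> (\<forall>\<psi>. test_function UNIV \<psi> \<longrightarrow>
     ((\<lambda>t. (LBINT x. regular W x t * \<psi> x) + weight W t * \<psi> (curve W t))
        \<longlongrightarrow> (LBINT x. v0 x * \<psi> x)) (at_right 0) \<and>
     ((\<lambda>t. LBINT x. velocity W x t * \<psi> x) \<longlongrightarrow> (LBINT x. u0 x * \<psi> x)) (at_right 0))"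

definition converges_in_measure_sense ::
  "real \<Rightarrow> nat \<Rightarrow> (real \<Rightarrow> real \<Rightarrow> real) \<Rightarrow> (real \<Rightarrow> real \<Rightarrow> real) \<Rightarrow> delta_wave \<Rightarrow> bool" where
  "converges_in_measure_sense \<alpha> k v u W \<longleftrightarrow>
     (\<forall>t>0. \<forall>x. x \<noteq> curve W t \<longrightarrow>
        ((\<lambda>\<epsilon>. similarity_solution \<alpha> k (u \<epsilon>) x t) \<longlongrightarrow> velocity W x t) (at_right 0)) \<and>
     (\<forall>t>0. ((\<lambda>\<epsilon>. u \<epsilon> (xi_sigma k (u \<epsilon>))) \<longlongrightarrow> velocity W (curve W t) t) (at_right 0)) \<and>
     (\<forall>\<phi>. test_function half_plane \<phi> \<longrightarrow>
        ((\<lambda>\<epsilon>. LBINT t:{0<..}. (LBINT x. similarity_solution \<alpha> k (v \<epsilon>) x t * \<phi> (x, t)))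
           \<longlongrightarrow> pairing W (\<lambda>_. 1) \<phi>) (at_right 0))"

subsection \<open>The delta shock\<close>

definition delta_shock_constants ::
  "nat \<Rightarrow> real \<Rightarrow> real \<Rightarrow> real \<Rightarrow> real \<Rightarrow> real \<Rightarrow> real \<Rightarrow> real \<Rightarrow> bool" where
  "delta_shock_constants k vm um vp up \<sigma> w0 ud \<longleftrightarrow>
     up ^ k < \<sigma> \<and> \<sigma> < um ^ k \<and>
     \<sigma> = ud ^ k \<and>
     w0 = - \<sigma> * (vm - vp) + (vm * um ^ k - vp * up ^ k) \<and>
     w0 * ud = - \<sigma> * (vm * um - vp * up) + (vm * um ^ (k + 1) - vp * up ^ (k + 1))"

definition shock_curve :: "real \<Rightarrow> nat \<Rightarrow> real \<Rightarrow> real \<Rightarrow> real" where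
  "shock_curve \<alpha> k \<sigma> t = \<sigma> / (\<alpha> * real k) * (1 - exp (- \<alpha> * real k * t))"

text \<open>The value of \<open>regular\<close> on the curve is immaterial, the curve being a null set.\<close>

definition delta_shock ::
  "real \<Rightarrow> nat \<Rightarrow> real \<Rightarrow> real \<Rightarrow> real \<Rightarrow> real \<Rightarrow> real \<Rightarrow> real \<Rightarrow> real \<Rightarrow> delta_wave" where
  "delta_shock \<alpha> k vm um vp up \<sigma> w0 ud =
     \<lparr> regular = (\<lambda>x t. if x < shock_curve \<alpha> k \<sigma> t then vm else vp),
       velocity = (\<lambda>x t. if x < shock_curve \<alpha> k \<sigma> t then um
                         else if x = shock_curve \<alpha> k \<sigma> t then ud else up),
       curve = shock_curve \<alpha> k \<sigma>,
       weight = (\<lambda>t. w0 / (\<alpha> * real k) * (1 - exp (- \<alpha> * real k * t))) \<rparr>"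

end

theory Submission
  imports Defs
begin

text \<open>
  Put \<open>z = \<xi>\<^sub>\<sigma>\<close> and \<open>f = v (u\<^sup>k - \<xi>)\<close>. Then \<open>f' = - v\<close> away from \<open>z\<close> and \<open>f\<close> is continuous and
  decreasing with \<open>f z = 0\<close>, so \<open>\<epsilon> u'' = f u'\<close> with \<open>\<bar>f\<bar> \<ge> min v\<^sub>- v\<^sub>+ \<bar>\<xi> - z\<bar>\<close> forces \<open>u\<close> to jump from
  \<open>u\<^sub>-\<close> to \<open>u\<^sub>+\<close> across \<open>z\<close> up to an error \<open>O(\<epsilon>)\<close>.
  Integrating \<open>(\<epsilon> u' - f (u - u z))' = v (u - u z)\<close> over a small interval around \<open>z\<close> shows that \<open>u z\<close> is an
  approximate root of the strictly increasing function
  \<open>d \<mapsto> v\<^sub>+ (d - u\<^sub>+) (d\<^sup>k - u\<^sub>+\<^sup>k) - v\<^sub>- (u\<^sub>- - d) (u\<^sub>-\<^sup>k - d\<^sup>k)\<close>, whose unique root is \<open>u\<^sub>\<delta>\<close>.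
  Hence \<open>z \<rightarrow> \<sigma>\<close>, and \<open>f\<close> converges boundedly to a function with a jump at \<open>\<sigma>\<close>; its distributional
  derivative is the delta shock.\<close>

subsection \<open>The shock constants\<close>

text \<open>The obstacle is that \<open>v\<close> has no upper bound uniform in \<epsilon> near
  \<open>z\<close>: the bounds drawn from its exponential formula blow up there, and this is where
  the Dirac mass forms. So \<open>v\<close> enters near \<open>z\<close> only as minus the
  derivative of the flux, which is monotone and hence controlled by its values at two points away
  from the shock. The defect function is what remains of the jump relations once \<sigma> and
  \<open>w0\<close> are eliminated. It appears a second time, up to terms of order \<delta>, as the
  limit of the momentum balance of the profile over a window of radius \<delta> around
  \<open>z\<close>. The window has to be fixed before \<epsilon> tends to 0, since the layer
  estimates degenerate together with \<delta>. Convergence of \<open>z\<close> is a consequence of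
  this balance, so the balance is formulated relative to the moving \<open>z\<close>. Oddness of
  \<open>k\<close> makes the power injective and increasing for states of any sign; this is what
  lets closeness of the powers be turned into closeness of the velocities.\<close>

definition shock_defect :: "nat \<Rightarrow> real \<Rightarrow> real \<Rightarrow> real \<Rightarrow> real \<Rightarrow> real \<Rightarrow> real" where
  "shock_defect k vm um vp up d =
     vp * ((d - up) * (d ^ k - up ^ k)) - vm * ((um - d) * (um ^ k - d ^ k))"

lemma power_inject_odd: "odd k \<Longrightarrow> x ^ k = y ^ k \<longleftrightarrow> x = (y::real)"
  by (metis odd_real_root_power_cancel)

lemma power_less_odd_iff: "odd k \<Longrightarrow> x ^ k < y ^ k \<longleftrightarrow> x < (y::real)"
  by (metis linorder_not_less order_less_le power_inject_odd power_mono_odd)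

text \<open>Between \<open>up\<close> and \<open>um\<close> both factors of the first product are
  nonnegative and strictly increasing, those of the second nonnegative and strictly
  decreasing.\<close>

lemma shock_defect_strict_mono:
  assumes "odd k" "vm > 0" "vp > 0" "up \<le> x" "x < y" "y \<le> um"
  shows "shock_defect k vm um vp up x < shock_defect k vm um vp up y"
proof -
  have p: "up ^ k \<le> x ^ k" "x ^ k < y ^ k" "y ^ k \<le> um ^ k"
    using assms by (auto simp: power_mono_odd power_less_odd_iff)
  have "(x - up) * (x ^ k - up ^ k) < (y - up) * (y ^ k - up ^ k)"
    using assms p by (intro mult_strict_mono') auto
  moreover have "(um - y) * (um ^ k - y ^ k) < (um - x) * (um ^ k - x ^ k)"
    using assms p by (intro mult_strict_mono') auto
  ultimately show ?thesis
    unfolding shock_defect_def using assms(2,3)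
    by (smt (verit) mult_strict_left_mono)
qed

lemma shock_defect_root:
  assumes "odd k" "vm > 0" "vp > 0" "up < um"
  obtains ud where "up < ud" "ud < um" "shock_defect k vm um vp up ud = 0"
proof -
  have p: "up ^ k < um ^ k" using assms by (simp add: power_less_odd_iff)
  \<comment> \<open>The strict signs at the end states give the root and also keep it off the end
    points, which is the strictness in the entropy condition.\<close>
  have lo: "shock_defect k vm um vp up up < 0" and hi: "0 < shock_defect k vm um vp up um"
    using assms p unfolding shock_defect_def by auto
  have "\<exists>x\<ge>up. x \<le> um \<and> shock_defect k vm um vp up x = 0"
    using lo hi assms(4) by (intro IVT') (auto simp: shock_defect_def intro!: continuous_intros)
  then obtain x where x: "up \<le> x" "x \<le> um" "shock_defect k vm um vp up x = 0" by blast
  then have "x \<noteq> up" "x \<noteq> um" using lo hi by auto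
  with x that[of x] show thesis by simp
qed

text \<open>With \<sigma> = \<open>ud ^ k\<close>, the difference of the two sides of the momentum
  relation factors into the defect, and oddness turns the entropy condition on \<open>ud ^ k\<close>
  into one on \<open>ud\<close>. Existence and uniqueness of the three constants become a statement
  about one scalar root.\<close>

lemma delta_shock_constants_iff:
  assumes "odd k"
  shows "delta_shock_constants k vm um vp up \<sigma> w0 ud \<longleftrightarrow>
    up < ud \<and> ud < um \<and> shock_defect k vm um vp up ud = 0 \<and> \<sigma> = ud ^ k \<and>
    w0 = - \<sigma> * (vm - vp) + (vm * um ^ k - vp * up ^ k)"
proof -
  have "(- \<sigma> * (vm - vp) + (vm * um ^ k - vp * up ^ k)) * ud
      = - \<sigma> * (vm * um - vp * up) + (vm * um ^ (k + 1) - vp * up ^ (k + 1))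
      \<longleftrightarrow> shock_defect k vm um vp up ud = 0" if "\<sigma> = ud ^ k"
    unfolding shock_defect_def that by (auto simp: algebra_simps)
  then show ?thesis
    unfolding delta_shock_constants_def using assms
    by (auto simp: power_less_odd_iff)
qed

text \<open>A strictly increasing function is small only near its root: as long as
  \<open>d e\<close> is on the wrong side of a point \<open>a\<close> separated from
  \<open>ud\<close>, the defect stays away from 0.\<close>

lemma shock_defect_tendsto_imp:
  fixes d :: "'a \<Rightarrow> real"
  assumes "odd k" "vm > 0" "vp > 0" "up < ud" "ud < um" "shock_defect k vm um vp up ud = 0"
    and d: "eventually (\<lambda>e. up \<le> d e \<and> d e \<le> um) F"
    and lim: "((\<lambda>e. shock_defect k vm um vp up (d e)) \<longlongrightarrow> 0) F"
  shows "(d \<longlongrightarrow> ud) F"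
proof (rule order_tendstoI)
  note mono = shock_defect_strict_mono[OF assms(1-3)]
  fix a assume "a < ud"
  \<comment> \<open>Strict monotonicity is available only between \<open>up\<close> and
    \<open>um\<close>, where \<open>d e\<close> lies; clipping \<open>a\<close> to that range loses
    nothing.\<close>
  define a' where "a' = max a up"
  have "shock_defect k vm um vp up a' < 0"
    using mono[of up a' ud um] assms \<open>a < ud\<close> by (auto simp: a'_def)
  with lim have "eventually (\<lambda>e. shock_defect k vm um vp up a' < shock_defect k vm um vp up (d e)) F"
    by (rule order_tendstoD)
  with d show "eventually (\<lambda>e. a < d e) F"
  proof eventually_elim
    case (elim e)
    then show ?case
      using mono[of up "d e" a' um] \<open>a < ud\<close> assms(4,5) unfolding a'_def
      by (smt (verit, best))
  qed
next
  note mono = shock_defect_strict_mono[OF assms(1-3)]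
  fix a assume "ud < a"
  define a' where "a' = min a um"
  have "0 < shock_defect k vm um vp up a'"
    using mono[of up ud a' um] assms \<open>ud < a\<close> by (auto simp: a'_def)
  with lim have "eventually (\<lambda>e. shock_defect k vm um vp up (d e) < shock_defect k vm um vp up a') F"
    by (rule order_tendstoD)
  with d show "eventually (\<lambda>e. d e < a) F"
  proof eventually_elim
    case (elim e)
    then show ?case
      using mono[of up a' "d e" um] \<open>ud < a\<close> assms(4,5) unfolding a'_def
      by (smt (verit, best))
  qed
qed

text \<open>The inverse of the odd power need not be Lipschitz near 0, hence the additive error
  \<eta>. On the compact set where \<open>x\<close> and \<open>y\<close> are at least \<eta> apart
  the quotient of the two distances is continuous, so it has a bound \<open>C\<close>.\<close>

lemma dist_le_power_dist:
  fixes lo hi :: real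
  assumes "odd k" "\<eta> > 0"
  obtains C where "C > 0"
    "\<And>x y. x \<in> {lo..hi} \<Longrightarrow> y \<in> {lo..hi} \<Longrightarrow> \<bar>x - y\<bar> \<le> \<eta> + C * \<bar>x ^ k - y ^ k\<bar>"
proof -
  define K where "K = {p \<in> {lo..hi} \<times> {lo..hi}. \<eta> \<le> \<bar>fst p - snd p\<bar>}"
  have "K = ({lo..hi} \<times> {lo..hi}) \<inter> {p. \<eta> \<le> \<bar>fst p - snd p\<bar>}" by (auto simp: K_def)
  moreover have "closed {p::real\<times>real. \<eta> \<le> \<bar>fst p - snd p\<bar>}"
    by (intro closed_Collect_le continuous_intros)
  ultimately have K: "compact K" by (simp add: compact_Int_closed compact_Times)
  have nz: "fst p ^ k \<noteq> snd p ^ k" if "p \<in> K" for p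
    using that assms by (auto simp: K_def power_inject_odd)
  have "continuous_on K (\<lambda>p. \<bar>fst p - snd p\<bar> / \<bar>fst p ^ k - snd p ^ k\<bar>)"
    using nz by (intro continuous_intros) auto
  then have "bounded ((\<lambda>p. \<bar>fst p - snd p\<bar> / \<bar>fst p ^ k - snd p ^ k\<bar>) ` K)"
    using K by (intro compact_imp_bounded compact_continuous_image)
  then obtain C where C: "C > 0" "\<And>p. p \<in> K \<Longrightarrow> \<bar>\<bar>fst p - snd p\<bar> / \<bar>fst p ^ k - snd p ^ k\<bar>\<bar> \<le> C"
    unfolding bounded_pos by auto
  show thesis
  proof (rule that[OF C(1)])
    fix x y assume xy: "x \<in> {lo..hi}" "y \<in> {lo..hi}"
    show "\<bar>x - y\<bar> \<le> \<eta> + C * \<bar>x ^ k - y ^ k\<bar>"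
    proof (cases "(x, y) \<in> K")
      case True
      then have "\<bar>x - y\<bar> / \<bar>x ^ k - y ^ k\<bar> \<le> C" and "x ^ k \<noteq> y ^ k"
        using C(2)[OF True] nz[OF True] by auto
      then have "\<bar>x - y\<bar> \<le> C * \<bar>x ^ k - y ^ k\<bar>" by (simp add: field_simps)
      then show ?thesis using assms by simp
    next
      case False
      then have "\<bar>x - y\<bar> < \<eta>" using xy by (auto simp: K_def)
      moreover have "0 \<le> C * \<bar>x ^ k - y ^ k\<bar>" using C by simp
      ultimately show ?thesis by linarith
    qed
  qed
qed

subsection \<open>Viscous profiles\<close>

lemma has_real_derivative_reflect:
  fixes f :: "real \<Rightarrow> real"
  assumes "(f has_real_derivative D) (at (- x))"
  shows "((\<lambda>y. f (- y)) has_real_derivative - D) (at x)"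
  using assms by (simp add: DERIV_mirror)

text \<open>The differential inequality makes \<open>U\<close> convex beyond \<open>z\<close>, so
  the slope at \<open>z + \<delta>\<close> is no steeper than the mean slope before it. This slope
  bound is then converted into the bound on the remaining height.\<close>

lemma viscous_layer_right:
  fixes U U1 U2 :: "real \<Rightarrow> real"
  assumes D1: "\<And>x. (U has_real_derivative U1 x) (at x)"
    and D2: "\<And>x. (U1 has_real_derivative U2 x) (at x)"
    and neg: "\<And>x. U1 x \<le> 0" and lim: "(U \<longlongrightarrow> L) at_top"
    and ode: "\<And>x. x > z \<Longrightarrow> - (c * (x - z)) * U1 x \<le> \<epsilon> * U2 x"
    and pos: "c > 0" "\<epsilon> > 0" "\<delta> > 0"
  shows "- U1 (z + \<delta>) \<le> (U z - L) / \<delta>"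
    and "U (z + \<delta>) - L \<le> \<epsilon> * (U z - L) / (c * \<delta>\<^sup>2)"
proof -
  have decr: "U y \<le> U x" if "x \<le> y" for x y
    using that D1 neg by (intro DERIV_nonpos_imp_nonincreasing[of x y U]) blast+
  have L_le: "L \<le> U x" for x
    by (rule tendsto_upperbound[OF lim]) (auto simp: eventually_at_top_linorder intro!: exI[of _ x] decr)
  have U2: "0 \<le> U2 x" if "x > z" for x
  proof -
    have "0 \<le> - (c * (x - z)) * U1 x" using that pos neg[of x] by (simp add: mult_nonneg_nonpos)
    then have "0 \<le> \<epsilon> * U2 x" using ode[OF that] by linarith
    then show ?thesis using pos by (simp add: zero_le_mult_iff)
  qed
  obtain \<zeta> where \<zeta>: "z < \<zeta>" "\<zeta> < z + \<delta>" "U (z + \<delta>) - U z = (z + \<delta> - z) * U1 \<zeta>"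
    using MVT2[of z "z + \<delta>" U U1] D1 pos by auto
  have "U1 \<zeta> \<le> U1 (z + \<delta>)"
    using \<zeta> D2 U2 by (intro DERIV_nonneg_imp_nondecreasing[of \<zeta> "z + \<delta>" U1]) (auto intro: order_less_le_trans)
  then have "\<delta> * U1 \<zeta> \<le> \<delta> * U1 (z + \<delta>)" using pos by simp
  then have "\<delta> * - U1 (z + \<delta>) \<le> U z - L"
    using \<zeta>(3) L_le[of "z + \<delta>"] by simp
  then show slope: "- U1 (z + \<delta>) \<le> (U z - L) / \<delta>"
    using pos by (simp add: field_simps)
  \<comment> \<open>Beyond \<open>z + \<delta>\<close> the damping coefficient is at least
    \<open>c * \<delta>\<close>, so \<open>\<epsilon> * U1 + c * \<delta> * U\<close> is
    nondecreasing there. At the far end \<open>U1\<close> is dropped by its sign, so its limit need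
    not be known.\<close>
  have le: "\<epsilon> * U1 (z + \<delta>) + c * \<delta> * U (z + \<delta>) \<le> c * \<delta> * U x" if "x \<ge> z + \<delta>" for x
  proof -
    have "\<epsilon> * U1 (z + \<delta>) + c * \<delta> * U (z + \<delta>) \<le> \<epsilon> * U1 x + c * \<delta> * U x"
    proof (rule DERIV_nonneg_imp_nondecreasing[OF that])
      fix y assume y: "z + \<delta> \<le> y"
      have "0 \<le> (- (c * (y - z)) + c * \<delta>) * U1 y"
        using y pos neg[of y] mult_left_mono[of \<delta> "y - z" c] by (intro mult_nonpos_nonpos) auto
      also have "\<dots> \<le> \<epsilon> * U2 y + c * \<delta> * U1 y"
        using ode[of y] y pos by (simp add: algebra_simps)
      finally show "\<exists>D. ((\<lambda>x. \<epsilon> * U1 x + c * \<delta> * U x) has_real_derivative D) (at y) \<and> 0 \<le> D"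
        by (intro exI conjI derivative_eq_intros D1 D2) (auto simp: D1 D2)
    qed
    also have "\<dots> \<le> c * \<delta> * U x" using pos neg[of x] by (simp add: mult_nonneg_nonpos)
    finally show ?thesis .
  qed
  have "\<epsilon> * U1 (z + \<delta>) + c * \<delta> * U (z + \<delta>) \<le> c * \<delta> * L"
    by (rule tendsto_lowerbound[OF tendsto_mult_left[OF lim]])
       (auto simp: eventually_at_top_linorder intro!: exI[of _ "z + \<delta>"] le)
  then have "c * \<delta> * (U (z + \<delta>) - L) \<le> \<epsilon> * - U1 (z + \<delta>)" by (simp add: algebra_simps)
  also have "\<dots> \<le> \<epsilon> * ((U z - L) / \<delta>)" using slope pos by (intro mult_left_mono) auto
  finally show "U (z + \<delta>) - L \<le> \<epsilon> * (U z - L) / (c * \<delta>\<^sup>2)"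
    using pos by (simp add: field_simps power2_eq_square)
qed

text \<open>The point reflection taking \<open>U x\<close> to \<open>- U (- x)\<close> keeps the
  sign of the slope, reverses that of the second derivative and exchanges the half lines.\<close>

lemma viscous_layer_left:
  fixes U U1 U2 :: "real \<Rightarrow> real"
  assumes D1: "\<And>x. (U has_real_derivative U1 x) (at x)"
    and D2: "\<And>x. (U1 has_real_derivative U2 x) (at x)"
    and neg: "\<And>x. U1 x \<le> 0" and lim: "(U \<longlongrightarrow> L) at_bot"
    and ode: "\<And>x. x < z \<Longrightarrow> \<epsilon> * U2 x \<le> c * (z - x) * U1 x"
    and pos: "c > 0" "\<epsilon> > 0" "\<delta> > 0"
  shows "- U1 (z - \<delta>) \<le> (L - U z) / \<delta>"
    and "L - U (z - \<delta>) \<le> \<epsilon> * (L - U z) / (c * \<delta>\<^sup>2)"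
proof -
  have A1: "((\<lambda>y. - U (- y)) has_real_derivative U1 (- x)) (at x)" for x
    using DERIV_minus[OF has_real_derivative_reflect[OF D1[of "- x"]]] by simp
  have A2: "((\<lambda>y. U1 (- y)) has_real_derivative - U2 (- x)) (at x)" for x
    by (rule has_real_derivative_reflect[OF D2])
  have A3: "((\<lambda>y. - U (- y)) \<longlongrightarrow> - L) at_top"
    using lim by (intro tendsto_minus) (simp add: filterlim_at_bot_mirror)
  have A4: "- (c * (x - (- z))) * U1 (- x) \<le> \<epsilon> * (- U2 (- x))" if "x > - z" for x
    using ode[of "- x"] that by (simp add: algebra_simps)
  note R = viscous_layer_right[where z = "- z", OF A1 A2 neg A3 A4 pos]
  show "- U1 (z - \<delta>) \<le> (L - U z) / \<delta>" using R(1) by simp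
  show "L - U (z - \<delta>) \<le> \<epsilon> * (L - U z) / (c * \<delta>\<^sup>2)" using R(2) by simp
qed

text \<open>Here \<open>p\<close> stands for the power of the velocity. The integrand is
  nonnegative, and it is at most \<open>- P1 s / (x - z)\<close>, whose integral is explicit; this
  gives both bounds. The derivative formula is the mass equation: the logarithmic derivative of
  \<open>v\<close> is \<open>- P1 / (p - x)\<close>, so the terms with \<open>P1\<close>
  cancel.\<close>

lemma density_right:
  fixes p P1 v :: "real \<Rightarrow> real"
  assumes D: "\<And>x. (p has_real_derivative P1 x) (at x)"
    and cont: "continuous_on UNIV P1" and neg: "\<And>x. P1 x \<le> 0"
    and lim: "(p \<longlongrightarrow> L) at_top" and fixp: "p z = z" and w: "w > 0"
    and v: "\<And>x. x > z \<Longrightarrow> v x = w * exp (LBINT s=ereal x..\<infinity>. P1 s / (p s - s))"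
    and x: "x > z"
  shows "w \<le> v x" and "v x \<le> w * exp ((p x - L) / (x - z))"
    and "((\<lambda>y. v y * (p y - y)) has_real_derivative - v x) (at x)"
proof -
  define q where "q s = P1 s / (p s - s)" for s
  define J where "J y = (LBINT s=ereal y..\<infinity>. q s)" for y
  have decr: "p y \<le> p x" if "x \<le> y" for x y
    using that D neg by (intro DERIV_nonpos_imp_nonincreasing[of x y p]) blast+
  have gap: "y - z \<le> y - p y" if "y \<ge> z" for y
    using decr[OF that] fixp by simp
  have contp: "continuous_on A p" for A
    using D by (meson DERIV_continuous_on has_field_derivative_at_within)
  have nz: "p y - y \<noteq> 0" if "y > z" for y using gap[of y] that by simp
  have contq: "continuous_on A q" if "A \<subseteq> {z<..}" for A
    unfolding q_def using that nz
    by (intro continuous_intros contp continuous_on_subset[OF cont]) auto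
  have q0: "0 \<le> q s" if "s > z" for s
    unfolding q_def using gap[of s] that neg[of s] by (intro divide_nonpos_neg) auto
  have qle: "q s \<le> - P1 s / (y - z)" if "y > z" "s \<ge> y" for s y
  proof -
    have "q s = - P1 s / (s - p s)" unfolding q_def by (metis minus_diff_eq minus_divide_divide)
    also have "\<dots> \<le> - P1 s / (y - z)"
      using that gap[of s] neg[of s] by (intro divide_left_mono) (auto intro!: mult_pos_pos)
    finally show ?thesis .
  qed
  \<comment> \<open>No decay of \<open>P1\<close> is assumed: its constant sign and the finite limit
    of \<open>p\<close> give integrability on the half line.\<close>
  have FTC: "set_integrable lborel {y<..} (\<lambda>s. - P1 s)" "(LBINT s:{y<..}. - P1 s) = p y - L" for y
  proof -
    have tl: "((\<lambda>s. - p s) \<longlongrightarrow> - L) at_top" by (intro tendsto_minus lim)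
    have tr: "((\<lambda>s. - p s) \<longlongrightarrow> - p y) (at_right y)"
      using contp[of UNIV] by (intro tendsto_minus) (simp add: continuous_on_def tendsto_within_subset[of _ _ y UNIV])
    have tl': "(((\<lambda>s. - p s) \<circ> real_of_ereal) \<longlongrightarrow> - L) (at_left \<infinity>)"
      using tl by (simp only: ereal_tendsto_simps)
    have tr': "(((\<lambda>s. - p s) \<circ> real_of_ereal) \<longlongrightarrow> - p y) (at_right (ereal y))"
      using tr by (simp only: ereal_tendsto_simps)
    have isc: "isCont (\<lambda>s. - P1 s) s" for s
      using cont by (intro continuous_minus) (simp add: continuous_on_eq_continuous_at)
    have nn: "AE s in lborel. ereal y < ereal s \<longrightarrow> ereal s < \<infinity> \<longrightarrow> 0 \<le> - P1 s"
      using neg by simp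
    have less: "ereal y < \<infinity>" by simp
    have DD: "((\<lambda>s. - p s) has_real_derivative - P1 s) (at s)" for s by (rule DERIV_minus[OF D])
    note R = interval_integral_FTC_nonneg[OF less DD isc nn tr' tl']
    show "set_integrable lborel {y<..} (\<lambda>s. - P1 s)" using R(1) by simp
    show "(LBINT s:{y<..}. - P1 s) = p y - L"
      using R(2) unfolding interval_integral_to_infinity_eq by simp
  qed
  have intq: "set_integrable lborel {y<..} q" if "y > z" for y
  proof (rule set_integrable_bound)
    show "set_integrable lborel {y<..} (\<lambda>s. - P1 s / (y - z))"
      by (intro set_integrable_divide FTC)
    show "set_borel_measurable lborel {y<..} q"
      using borel_measurable_continuous_on_indicator[OF _ contq, of "{y<..}"] that
      by (auto simp: set_borel_measurable_def)
    show "AE s in lborel. s \<in> {y<..} \<longrightarrow> norm (q s) \<le> norm (- P1 s / (y - z))"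
    proof (intro AE_I2 impI)
      fix s assume "s \<in> {y<..}"
      then have "0 \<le> q s" "q s \<le> - P1 s / (y - z)" using q0[of s] qle[OF that, of s] that by auto
      then show "norm (q s) \<le> norm (- P1 s / (y - z))" unfolding real_norm_def by linarith
    qed
  qed
  have J: "J y = (LBINT s:{y<..}. q s)" for y
    unfolding J_def by (rule interval_integral_to_infinity_eq)
  have vJ: "v y = w * exp (J y)" if "y > z" for y using v[OF that] by (simp add: J_def q_def)
  have "0 \<le> J x" unfolding J set_lebesgue_integral_def
    using q0 x by (intro integral_nonneg_AE AE_I2) (auto simp: indicator_def)
  then show "w \<le> v x" using vJ[OF x] w by simp
  have "J x \<le> (LBINT s:{x<..}. - P1 s / (x - z))"
    unfolding J using qle[OF x]
    by (intro set_integral_mono intq[OF x] set_integrable_divide FTC) auto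
  also have "\<dots> = (p x - L) / (x - z)" by (simp only: set_integral_divide_zero FTC(2))
  finally show "v x \<le> w * exp ((p x - L) / (x - z))" using vJ[OF x] w by simp
  \<comment> \<open>Splitting at a point strictly between \<open>z\<close> and \<open>x\<close>
    leaves a proper integral of a continuous function, away from the singularity of \<open>q\<close>
    at \<open>z\<close>, plus a constant.\<close>
  define b where "b = (z + x) / 2"
  have b: "z < b" "b < x" using x by (auto simp: b_def)
  have Jb: "J y = J b - (LBINT s=ereal b..ereal y. q s)" if "y > b" for y
  proof -
    have "(LBINT s=ereal b..ereal y. q s) + (LBINT s=ereal y..\<infinity>. q s) = (LBINT s=ereal b..\<infinity>. q s)"
      using that intq[OF b(1)]
      by (intro interval_integral_sum) (auto simp: interval_lebesgue_integrable_def min_def max_def)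
    then show ?thesis by (simp add: J_def)
  qed
  have "((\<lambda>u. LBINT s=ereal b..ereal u. q s) has_vector_derivative q x) (at x within {b..x + 1})"
    using b by (intro interval_integral_FTC2 contq) auto
  then have "((\<lambda>u. LBINT s=ereal b..ereal u. q s) has_vector_derivative q x) (at x)"
    using b at_within_Icc_at[of b x "x + 1"] by simp
  then have "((\<lambda>u. J b - (LBINT s=ereal b..ereal u. q s)) has_real_derivative - q x) (at x)"
    by (auto intro!: derivative_eq_intros simp: has_real_derivative_iff_has_vector_derivative)
  then have DJ: "(J has_real_derivative - q x) (at x)"
    by (rule has_field_derivative_transform_within_open[of _ _ _ "{b<..}"]) (use b Jb in auto)
  have "((\<lambda>y. w * exp (J y) * (p y - y)) has_real_derivative
      w * (exp (J x) * - q x) * (p x - x) + (w * exp (J x)) * (P1 x - 1)) (at x)"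
    by (auto intro!: derivative_eq_intros D DJ)
  moreover have "w * (exp (J x) * - q x) * (p x - x) + (w * exp (J x)) * (P1 x - 1) = - v x"
    using gap[of x] x vJ[OF x] by (simp add: q_def field_simps)
  ultimately have "((\<lambda>y. w * exp (J y) * (p y - y)) has_real_derivative - v x) (at x)" by simp
  then show "((\<lambda>y. v y * (p y - y)) has_real_derivative - v x) (at x)"
    by (rule has_field_derivative_transform_within_open[where S = "{z<..}"]) (use x in \<open>simp_all add: vJ\<close>)
qed

text \<open>Again by point reflection: \<open>p x\<close> becomes \<open>- p (- x)\<close>, the
  fixed point becomes \<open>- z\<close>, and the flux changes sign together with its argument, so
  its derivative keeps the form \<open>- v\<close>.\<close>

lemma density_left:
  fixes p P1 v :: "real \<Rightarrow> real"
  assumes D: "\<And>x. (p has_real_derivative P1 x) (at x)"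
    and cont: "continuous_on UNIV P1" and neg: "\<And>x. P1 x \<le> 0"
    and lim: "(p \<longlongrightarrow> L) at_bot" and fixp: "p z = z" and w: "w > 0"
    and v: "\<And>x. x < z \<Longrightarrow> v x = w * exp (- (LBINT s=-\<infinity>..ereal x. P1 s / (p s - s)))"
    and x: "x < z"
  shows "w \<le> v x" and "v x \<le> w * exp ((L - p x) / (z - x))"
    and "((\<lambda>y. v y * (p y - y)) has_real_derivative - v x) (at x)"
proof -
  have A1: "((\<lambda>y. - p (- y)) has_real_derivative P1 (- x)) (at x)" for x
    using DERIV_minus[OF has_real_derivative_reflect[OF D[of "- x"]]] by simp
  have A2: "continuous_on UNIV (\<lambda>y. P1 (- y))"
    by (rule continuous_on_compose2[OF cont]) (auto intro!: continuous_intros)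
  have A3: "((\<lambda>y. - p (- y)) \<longlongrightarrow> - L) at_top"
    using lim by (intro tendsto_minus) (simp add: filterlim_at_bot_mirror)
  have A4: "v (- x) = w * exp (LBINT s=ereal x..\<infinity>. P1 (- s) / (- p (- s) - s))" if "x > - z" for x
  proof -
    have "(LBINT s=-\<infinity>..ereal (- x). P1 s / (p s - s))
        = (LBINT s=ereal x..\<infinity>. P1 (- s) / (p (- s) - (- s)))"
      by (subst interval_integral_reflect) simp
    also have "\<dots> = (LBINT s=ereal x..\<infinity>. - (P1 (- s) / (- p (- s) - s)))"
      by (intro interval_integral_cong) (simp add: minus_divide_right)
    also have "\<dots> = - (LBINT s=ereal x..\<infinity>. P1 (- s) / (- p (- s) - s))"
      by (rule interval_lebesgue_integral_uminus)
    finally show ?thesis using v[of "- x"] that by simp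
  qed
  have fixp': "- p (- (- z)) = - z" using fixp by simp
  have x': "- z < - x" using x by simp
  note R = density_right[where v = "\<lambda>x. v (- x)", OF A1 A2 neg A3 fixp' w A4 x']
  show "w \<le> v x" using R(1) by simp
  show "v x \<le> w * exp ((L - p x) / (z - x))" using R(2) by simp
  have "((\<lambda>y. - (v y * (- p y + y))) has_real_derivative - v x) (at x)"
    using DERIV_minus[OF has_real_derivative_reflect[OF R(3)]] by simp
  then show "((\<lambda>y. v y * (p y - y)) has_real_derivative - v x) (at x)"
    by (simp add: algebra_simps)
qed

text \<open>A mean value comparison that tolerates finitely many points of mere continuity. The
  gauge form of the fundamental theorem supplies integrability of the derivatives, so
  \<open>H'\<close> may be unbounded near such a point, as \<open>v\<close> can be near
  \<open>z\<close>.\<close>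

lemma increment_le_increment:
  fixes G H :: "real \<Rightarrow> real"
  assumes "finite S" "a \<le> b" "continuous_on {a..b} G" "continuous_on {a..b} H"
    and G: "\<And>x. x \<in> {a<..<b} - S \<Longrightarrow> (G has_real_derivative G' x) (at x)"
    and H: "\<And>x. x \<in> {a<..<b} - S \<Longrightarrow> (H has_real_derivative H' x) (at x)"
    and le: "\<And>x. x \<in> {a<..<b} - S \<Longrightarrow> \<bar>G' x\<bar> \<le> H' x"
  shows "\<bar>G b - G a\<bar> \<le> H b - H a"
proof -
  have IG: "(G' has_integral (G b - G a)) {a..b}"
    using assms by (intro fundamental_theorem_of_calculus_interior_strong[of S])
      (auto simp flip: has_real_derivative_iff_has_vector_derivative)
  have IH: "(H' has_integral (H b - H a)) {a..b}"
    using assms by (intro fundamental_theorem_of_calculus_interior_strong[of S])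
      (auto simp flip: has_real_derivative_iff_has_vector_derivative)
  have neg: "negligible (S \<union> {a, b})" using assms by (intro negligible_finite) auto
  \<comment> \<open>The bound on the derivatives is known only at interior points off
    \<open>S\<close>; setting both to 0 on the remaining null set makes it hold everywhere.\<close>
  define G1 where "G1 x = (if x \<in> S \<union> {a, b} then 0 else G' x)" for x
  define H1 where "H1 x = (if x \<in> S \<union> {a, b} then 0 else H' x)" for x
  have IG1: "(G1 has_integral (G b - G a)) {a..b}"
    by (rule has_integral_spike[OF neg _ IG]) (auto simp: G1_def)
  have IH1: "(H1 has_integral (H b - H a)) {a..b}"
    by (rule has_integral_spike[OF neg _ IH]) (auto simp: H1_def)
  have "norm (integral {a..b} G1) \<le> integral {a..b} H1"
    using IG1 IH1 le
    by (intro integral_norm_bound_integral) (auto simp: G1_def H1_def has_integral_integrable)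
  then show ?thesis using IG1 IH1 by (simp add: integral_unique)
qed

section \<open>A single profile: flux, layer width and momentum balance\<close>

locale viscous_profile =
  fixes k :: nat and \<epsilon> vm um vp up :: real and v u :: "real \<Rightarrow> real"
  assumes odd_k: "odd k" and eps_pos: "\<epsilon> > 0" and vm_pos: "vm > 0" and vp_pos: "vp > 0"
    and profile: "similarity_profile k \<epsilon> vm um vp up v u"
begin

definition z :: real where "z = xi_sigma k u"

definition flux :: "real \<Rightarrow> real" where "flux x = v x * (u x ^ k - x)"

lemma fixed_point: "u z ^ k = z"
  and fixed_point_unique: "u x ^ k = x \<Longrightarrow> x = z"
proof -
  have ex1: "\<exists>!x. u x ^ k = x" using profile by (simp add: similarity_profile_def)
  show "u z ^ k = z" unfolding z_def xi_sigma_def using theI'[OF ex1] .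
  then show "u x ^ k = x \<Longrightarrow> x = z" using ex1 by blast
qed

lemma u_antimono: "x \<le> y \<Longrightarrow> u y \<le> u x"
  using profile by (auto simp: similarity_profile_def antimono_def)

lemma u_limits: "(u \<longlongrightarrow> um) at_bot" "(u \<longlongrightarrow> up) at_top"
  using profile by (auto simp: similarity_profile_def)

lemma u_range: "u x \<in> {up..um}"
proof -
  have "up \<le> u x"
    by (rule tendsto_upperbound[OF u_limits(2)])
      (auto simp: eventually_at_top_linorder intro!: exI[of _ x] u_antimono)
  moreover have "u x \<le> um"
    by (rule tendsto_lowerbound[OF u_limits(1)])
      (auto simp: eventually_at_bot_linorder intro!: exI[of _ x] u_antimono)
  ultimately show ?thesis by simp
qed

lemma u_power_antimono: "x \<le> y \<Longrightarrow> u y ^ k \<le> u x ^ k"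
  by (intro power_mono_odd odd_k u_antimono)

lemma u_power_range: "u x ^ k \<in> {up ^ k..um ^ k}"
  using u_range[of x] odd_k by (auto intro: power_mono_odd)

lemma z_range: "z \<in> {up ^ k..um ^ k}"
  using u_power_range[of z] fixed_point by simp

lemma DERIV_u: "(u has_real_derivative deriv u x) (at x)"
  and DERIV2_u: "(deriv u has_real_derivative deriv (deriv u) x) (at x)"
  using profile by (auto simp: similarity_profile_def C2_def DERIV_deriv_iff_real_differentiable)

lemma deriv_u_nonpos: "deriv u x \<le> 0"
proof (rule ccontr)
  assume "\<not> deriv u x \<le> 0"
  then obtain d where d: "d > 0" "\<forall>h>0. h < d \<longrightarrow> u x < u (x + h)"
    using DERIV_pos_inc_right[OF DERIV_u[of x]] by auto
  then have "u x < u (x + d / 2)" by (simp add: half_gt_zero)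
  then show False using u_antimono[of x "x + d / 2"] d(1) by linarith
qed

lemma continuous_u: "continuous_on A u"
  by (meson DERIV_u DERIV_continuous_on has_field_derivative_at_within)

lemma continuous_deriv_u: "continuous_on A (deriv u)"
  by (meson DERIV2_u DERIV_continuous_on has_field_derivative_at_within)

lemma DERIV_u_power: "((\<lambda>x. u x ^ k) has_real_derivative real k * u x ^ (k - 1) * deriv u x) (at x)"
  by (auto intro!: derivative_eq_intros DERIV_u)

lemma deriv_u_power: "deriv (\<lambda>x. u x ^ k) x = real k * u x ^ (k - 1) * deriv u x"
  by (rule DERIV_imp_deriv[OF DERIV_u_power])

lemma u_power_facts:
  "((\<lambda>x. u x ^ k) has_real_derivative deriv (\<lambda>x. u x ^ k) x) (at x)"
  "continuous_on UNIV (deriv (\<lambda>x. u x ^ k))"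
  "deriv (\<lambda>x. u x ^ k) x \<le> 0"
  "((\<lambda>x. u x ^ k) \<longlongrightarrow> um ^ k) at_bot" "((\<lambda>x. u x ^ k) \<longlongrightarrow> up ^ k) at_top"
proof -
  have eq: "deriv (\<lambda>x. u x ^ k) = (\<lambda>x. real k * u x ^ (k - 1) * deriv u x)"
    using deriv_u_power by blast
  show "((\<lambda>x. u x ^ k) has_real_derivative deriv (\<lambda>x. u x ^ k) x) (at x)"
    using DERIV_u_power by (simp add: eq)
  show "continuous_on UNIV (deriv (\<lambda>x. u x ^ k))"
    unfolding eq by (intro continuous_intros continuous_u continuous_deriv_u)
  have "0 \<le> u x ^ (k - 1)" using odd_k by (intro zero_le_even_power) auto
  then show "deriv (\<lambda>x. u x ^ k) x \<le> 0"
    unfolding eq using deriv_u_nonpos[of x] by (intro mult_nonneg_nonpos) auto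
qed (intro tendsto_power u_limits)+

lemma v_formula:
  "x < z \<Longrightarrow> v x = vm * exp (- (LBINT s=-\<infinity>..ereal x. deriv (\<lambda>r. u r ^ k) s / (u s ^ k - s)))"
  "x > z \<Longrightarrow> v x = vp * exp (LBINT s=ereal x..\<infinity>. deriv (\<lambda>r. u r ^ k) s / (u s ^ k - s))"
  using profile by (auto simp: similarity_profile_def z_def)

lemma density_facts_right:
  assumes "x > z"
  shows "vp \<le> v x" "v x \<le> vp * exp ((u x ^ k - up ^ k) / (x - z))"
    "(flux has_real_derivative - v x) (at x)"
  using density_right[OF u_power_facts(1,2,3,5) fixed_point vp_pos v_formula(2), of x] assms
  unfolding flux_def[abs_def] by auto

lemma density_facts_left:
  assumes "x < z"
  shows "vm \<le> v x" "v x \<le> vm * exp ((um ^ k - u x ^ k) / (z - x))"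
    "(flux has_real_derivative - v x) (at x)"
  using density_left[OF u_power_facts(1,2,3,4) fixed_point vm_pos v_formula(1), of x] assms
  unfolding flux_def[abs_def] by auto

lemma v_ge: "x \<noteq> z \<Longrightarrow> min vm vp \<le> v x"
  using density_facts_right(1)[of x] density_facts_left(1)[of x] by linarith

lemma v_pos: "x \<noteq> z \<Longrightarrow> 0 < v x"
  using v_ge[of x] vm_pos vp_pos by linarith

lemma DERIV_flux: "x \<noteq> z \<Longrightarrow> (flux has_real_derivative - v x) (at x)"
  using density_facts_right(3)[of x] density_facts_left(3)[of x] by linarith

lemma flux_z: "flux z = 0"
  by (simp add: flux_def fixed_point)

lemma continuous_flux: "continuous_on A flux"
proof -
  have "isCont flux x" for x
  proof (cases "x = z")
    case True
    have "(flux \<longlongrightarrow> 0) (at z)"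
      using profile unfolding flux_def[abs_def] z_def by (simp add: similarity_profile_def)
    then show ?thesis by (simp add: True isCont_def flux_z)
  next
    case False
    then show ?thesis using DERIV_flux DERIV_isCont by blast
  qed
  then show ?thesis by (simp add: continuous_at_imp_continuous_on)
qed

lemma flux_antimono:
  assumes "x \<le> y"
  shows "flux y \<le> flux x"
proof -
  have D: "((\<lambda>x. - flux x) has_real_derivative v x) (at x)" if "x \<noteq> z" for x
    using DERIV_minus[OF DERIV_flux[OF that]] by simp
  \<comment> \<open>Comparison with the constant 0 carries the sign of the derivative across
    \<open>z\<close>, where differentiability of the flux is not known.\<close>
  have "\<bar>0 - 0\<bar> \<le> - flux y - - flux x"
    by (rule increment_le_increment[of "{z}" x y "\<lambda>_. 0" "\<lambda>x. - flux x" "\<lambda>_. 0" v])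
      (auto intro!: continuous_intros continuous_flux D simp: assms less_imp_le[OF v_pos])
  then show ?thesis by simp
qed

text \<open>Off \<open>z\<close> the density is the flux divided by \<open>u x ^ k - x\<close>, a
  quotient of continuous functions whose denominator vanishes only at \<open>z\<close>. The
  unspecified value at \<open>z\<close> is frozen as a constant.\<close>

lemma v_measurable [measurable]: "v \<in> borel_measurable borel"
proof -
  have [measurable]: "flux \<in> borel_measurable borel" "u \<in> borel_measurable borel"
    using continuous_flux continuous_u by (auto intro: borel_measurable_continuous_onI)
  define c where "c = v z"
  have "(\<lambda>x. if x = z then c else flux x / (u x ^ k - x)) \<in> borel_measurable borel"
    by measurable
  also have "(\<lambda>x. if x = z then c else flux x / (u x ^ k - x)) = v"
    using fixed_point_unique by (auto simp: flux_def c_def)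
  finally show ?thesis .
qed

lemma viscous: "\<epsilon> * deriv (deriv u) x = flux x * deriv u x"
  using profile by (simp add: similarity_profile_def flux_def)

lemma flux_right: "x > z \<Longrightarrow> flux x \<le> - (min vm vp * (x - z))"
proof -
  assume x: "x > z"
  have "min vm vp * (x - z) \<le> v x * (x - u x ^ k)"
    using v_ge[of x] v_pos[of x] u_power_antimono[of z x] fixed_point x vm_pos vp_pos
    by (intro mult_mono) auto
  then show ?thesis by (simp add: flux_def algebra_simps)
qed

lemma flux_left: "x < z \<Longrightarrow> min vm vp * (z - x) \<le> flux x"
  unfolding flux_def
  using v_ge[of x] v_pos[of x] u_power_antimono[of x z] fixed_point vm_pos vp_pos
  by (intro mult_mono) auto

text \<open>The slope bounds do not contain \<epsilon>, so the viscous term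
  \<open>\<epsilon> * deriv u\<close> at \<open>z + \<delta>\<close> and \<open>z - \<delta>\<close>
  vanishes in the limit. Replacing the partial jumps at \<open>z\<close> by \<open>um - up\<close>
  frees the right sides from the profile.\<close>

lemma layer:
  assumes "\<delta> > 0"
  shows "\<bar>deriv u (z + \<delta>)\<bar> \<le> (um - up) / \<delta>" "\<bar>deriv u (z - \<delta>)\<bar> \<le> (um - up) / \<delta>"
    "u (z + \<delta>) - up \<le> \<epsilon> * (um - up) / (min vm vp * \<delta>\<^sup>2)"
    "um - u (z - \<delta>) \<le> \<epsilon> * (um - up) / (min vm vp * \<delta>\<^sup>2)"
proof -
  have c: "min vm vp > 0" using vm_pos vp_pos by simp
  have r: "- (min vm vp * (x - z)) * deriv u x \<le> \<epsilon> * deriv (deriv u) x" if "x > z" for x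
    unfolding viscous using flux_right[OF that] deriv_u_nonpos by (intro mult_right_mono_neg)
  have l: "\<epsilon> * deriv (deriv u) x \<le> min vm vp * (z - x) * deriv u x" if "x < z" for x
    unfolding viscous using flux_left[OF that] deriv_u_nonpos by (intro mult_right_mono_neg)
  note R = viscous_layer_right[OF DERIV_u DERIV2_u deriv_u_nonpos u_limits(2) r c eps_pos assms]
  note L = viscous_layer_left[OF DERIV_u DERIV2_u deriv_u_nonpos u_limits(1) l c eps_pos assms]
  have uz: "up \<le> u z" "u z \<le> um" using u_range[of z] by auto
  have "(u z - up) / \<delta> \<le> (um - up) / \<delta>" "(um - u z) / \<delta> \<le> (um - up) / \<delta>"
    using uz assms by (auto intro!: divide_right_mono)
  then show "\<bar>deriv u (z + \<delta>)\<bar> \<le> (um - up) / \<delta>" "\<bar>deriv u (z - \<delta>)\<bar> \<le> (um - up) / \<delta>"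
    using R(1) L(1) deriv_u_nonpos by (auto simp: abs_of_nonpos intro: order_trans)
  have "\<epsilon> * (u z - up) / (min vm vp * \<delta>\<^sup>2) \<le> \<epsilon> * (um - up) / (min vm vp * \<delta>\<^sup>2)"
    "\<epsilon> * (um - u z) / (min vm vp * \<delta>\<^sup>2) \<le> \<epsilon> * (um - up) / (min vm vp * \<delta>\<^sup>2)"
    using uz c eps_pos by (auto intro!: divide_right_mono mult_left_mono)
  then show "u (z + \<delta>) - up \<le> \<epsilon> * (um - up) / (min vm vp * \<delta>\<^sup>2)"
    "um - u (z - \<delta>) \<le> \<epsilon> * (um - up) / (min vm vp * \<delta>\<^sup>2)"
    using R(2) L(2) by linarith+
qed

text \<open>The mass of \<open>v\<close> near \<open>z\<close> sits where \<open>u\<^sup>k\<close> is close to \<open>z\<close>, since \<open>v (u\<^sup>k - \<xi>)\<close> is bounded.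
  Hence \<open>u\<close> is nearly \<open>u z\<close> on average with respect to \<open>v\<close>.\<close>

lemma momentum_balance:
  assumes "\<delta> > 0" "0 \<le> \<eta>" "0 \<le> C"
    and C: "\<And>x y. x \<in> {up..um} \<Longrightarrow> y \<in> {up..um} \<Longrightarrow> \<bar>x - y\<bar> \<le> \<eta> + C * \<bar>x ^ k - y ^ k\<bar>"
  shows "\<bar>flux (z - \<delta>) * (u (z - \<delta>) - u z) - flux (z + \<delta>) * (u (z + \<delta>) - u z)
      + \<epsilon> * (deriv u (z + \<delta>) - deriv u (z - \<delta>))\<bar>
    \<le> (\<eta> + 3 * C * \<delta>) * (flux (z - \<delta>) - flux (z + \<delta>))"
proof -
  define a b M where "a = z - \<delta>" and "b = z + \<delta>" and "M = flux a - flux b"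
  define G where "G x = \<epsilon> * deriv u x - flux x * (u x - u z)" for x
  \<comment> \<open>\<open>H\<close> is a primitive of
    \<open>C * M + (\<eta> + C * \<delta>) * v\<close>. The constant \<open>C * M\<close> dominates
    \<open>C * \<bar>flux x\<bar>\<close> on the window; the multiple of \<open>v\<close> absorbs
    \<eta> and the distance of \<open>x\<close> from \<open>z\<close>.\<close>
  define H where "H x = C * M * x - (\<eta> + C * \<delta>) * flux x" for x
  have ab: "a < z" "z < b" using assms by (auto simp: a_def b_def)
  have "\<bar>G b - G a\<bar> \<le> H b - H a"
  proof (rule increment_le_increment[of "{z}"])
    show "continuous_on {a..b} G" "continuous_on {a..b} H"
      unfolding G_def H_def
      by (intro continuous_intros continuous_flux continuous_u continuous_deriv_u)+
    fix x assume "x \<in> {a<..<b} - {z}"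
    then have x: "a \<le> x" "x \<le> b" "x \<noteq> z" "\<bar>x - z\<bar> \<le> \<delta>" by (auto simp: a_def b_def)
    show "(G has_real_derivative v x * (u x - u z)) (at x)"
      unfolding G_def using viscous[of x]
      by (auto intro!: derivative_eq_intros DERIV_flux DERIV_u DERIV2_u x simp: algebra_simps)
    show "(H has_real_derivative C * M + (\<eta> + C * \<delta>) * v x) (at x)"
      unfolding H_def by (auto intro!: derivative_eq_intros DERIV_flux x)
    have "\<bar>flux x\<bar> \<le> M"
      using flux_antimono[of a x] flux_antimono[of x b] flux_antimono[of a z] flux_antimono[of z b]
        flux_z x ab unfolding M_def by linarith
    \<comment> \<open>The fixed point relation replaces \<open>u z ^ k\<close> by \<open>z\<close>,
      which is within \<delta> of \<open>x\<close>.\<close>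
    have "\<bar>u x ^ k - u z ^ k\<bar> \<le> \<bar>u x ^ k - x\<bar> + \<delta>"
      using x(4) fixed_point by linarith
    then have "\<bar>u x - u z\<bar> \<le> \<eta> + C * (\<bar>u x ^ k - x\<bar> + \<delta>)"
      using C[OF u_range[of x] u_range[of z]] mult_left_mono[OF _ assms(3)] by (smt (verit))
    then have "v x * \<bar>u x - u z\<bar> \<le> v x * (\<eta> + C * (\<bar>u x ^ k - x\<bar> + \<delta>))"
      using v_pos[OF x(3)] by (intro mult_left_mono) auto
    also have "\<dots> = C * \<bar>flux x\<bar> + (\<eta> + C * \<delta>) * v x"
      using v_pos[OF x(3)] unfolding flux_def by (simp add: abs_mult distrib_left distrib_right mult_ac)
    also have "\<dots> \<le> C * M + (\<eta> + C * \<delta>) * v x"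
      using \<open>\<bar>flux x\<bar> \<le> M\<close> assms(3) by (simp add: mult_left_mono)
    finally show "\<bar>v x * (u x - u z)\<bar> \<le> C * M + (\<eta> + C * \<delta>) * v x"
      using v_pos[OF x(3)] by (simp add: abs_mult)
  qed (use ab in auto)
  \<comment> \<open>The linear term of \<open>H\<close> contributes
    \<open>2 * C * \<delta> * M\<close> over the window of length \<open>2 * \<delta>\<close>; with
    \<open>C * \<delta> * M\<close> from the flux term this makes the factor 3.\<close>
  moreover have "H b - H a = (\<eta> + 3 * C * \<delta>) * M"
    unfolding H_def M_def by (simp add: a_def b_def algebra_simps)
  moreover have "G b - G a = flux a * (u a - u z) - flux b * (u b - u z) + \<epsilon> * (deriv u b - deriv u a)"
    unfolding G_def by (simp add: algebra_simps)
  ultimately show ?thesis unfolding M_def a_def b_def by simp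
qed

end

subsection \<open>The limit of the shock position\<close>

locale viscous_family =
  fixes k :: nat and vm um vp up :: real and v u :: "real \<Rightarrow> real \<Rightarrow> real"
  assumes odd_k: "odd k" and vm_pos: "vm > 0" and vp_pos: "vp > 0" and up_less_um: "up < um"
    and profiles: "\<And>\<epsilon>. \<epsilon> > 0 \<Longrightarrow> similarity_profile k \<epsilon> vm um vp up (v \<epsilon>) (u \<epsilon>)"
begin

lemma viscous_profileI: "\<epsilon> > 0 \<Longrightarrow> viscous_profile k \<epsilon> vm um vp up (v \<epsilon>) (u \<epsilon>)"
  using odd_k vm_pos vp_pos profiles by unfold_locales auto

abbreviation z :: "real \<Rightarrow> real" where "z \<epsilon> \<equiv> viscous_profile.z k (u \<epsilon>)"
abbreviation flux :: "real \<Rightarrow> real \<Rightarrow> real" where "flux \<epsilon> \<equiv> viscous_profile.flux k (v \<epsilon>) (u \<epsilon>)"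

lemma eventually_profile:
  assumes "\<And>\<epsilon>. viscous_profile k \<epsilon> vm um vp up (v \<epsilon>) (u \<epsilon>) \<Longrightarrow> P \<epsilon>"
  shows "eventually P (at_right (0::real))"
  using eventually_at_right_less[of 0] by eventually_elim (intro assms viscous_profileI)

text \<open>The point may move with \<epsilon> as long as it keeps distance \<delta> from
  \<open>z \<epsilon>\<close>; this serves both \<open>z \<epsilon> + \<delta>\<close> and fixed
  points. The layer estimate squeezes the velocity, and the exponent in the upper bound of the
  density then tends to 0.\<close>

lemma right_limits:
  assumes "\<delta> > 0" and x: "eventually (\<lambda>\<epsilon>. z \<epsilon> + \<delta> \<le> x \<epsilon>) (at_right 0)"
  shows "((\<lambda>\<epsilon>. u \<epsilon> (x \<epsilon>)) \<longlongrightarrow> up) (at_right 0)" "((\<lambda>\<epsilon>. v \<epsilon> (x \<epsilon>)) \<longlongrightarrow> vp) (at_right 0)"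
proof -
  note ev = x eventually_at_right_less[of 0]
  have *: "up \<le> u \<epsilon> (x \<epsilon>) \<and> u \<epsilon> (x \<epsilon>) \<le> up + \<epsilon> * (um - up) / (min vm vp * \<delta>\<^sup>2) \<and>
      vp \<le> v \<epsilon> (x \<epsilon>) \<and> v \<epsilon> (x \<epsilon>) \<le> vp * exp ((u \<epsilon> (x \<epsilon>) ^ k - up ^ k) / \<delta>)"
    if "z \<epsilon> + \<delta> \<le> x \<epsilon>" "\<epsilon> > 0" for \<epsilon>
  proof -
    interpret P: viscous_profile k \<epsilon> vm um vp up "v \<epsilon>" "u \<epsilon>" using that by (intro viscous_profileI)
    have zx: "P.z < x \<epsilon>" using that assms by simp
    have "(u \<epsilon> (x \<epsilon>) ^ k - up ^ k) / (x \<epsilon> - P.z) \<le> (u \<epsilon> (x \<epsilon>) ^ k - up ^ k) / \<delta>"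
      using that assms P.u_power_range[of "x \<epsilon>"] by (intro divide_left_mono) auto
    then have "vp * exp ((u \<epsilon> (x \<epsilon>) ^ k - up ^ k) / (x \<epsilon> - P.z)) \<le> vp * exp ((u \<epsilon> (x \<epsilon>) ^ k - up ^ k) / \<delta>)"
      using vp_pos by simp
    then show ?thesis
      using P.density_facts_right(1,2)[OF zx] P.u_range[of "x \<epsilon>"] P.u_antimono[OF that(1)] P.layer(3)[OF assms(1)]
      by auto
  qed
  have ev': "eventually (\<lambda>\<epsilon>. up \<le> u \<epsilon> (x \<epsilon>)) (at_right 0)"
    "eventually (\<lambda>\<epsilon>. u \<epsilon> (x \<epsilon>) \<le> up + \<epsilon> * (um - up) / (min vm vp * \<delta>\<^sup>2)) (at_right 0)"
    "eventually (\<lambda>\<epsilon>. vp \<le> v \<epsilon> (x \<epsilon>)) (at_right 0)"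
    "eventually (\<lambda>\<epsilon>. v \<epsilon> (x \<epsilon>) \<le> vp * exp ((u \<epsilon> (x \<epsilon>) ^ k - up ^ k) / \<delta>)) (at_right 0)"
    by (use ev in eventually_elim, use * in blast)+
  have "((\<lambda>\<epsilon>. up + \<epsilon> * (um - up) / (min vm vp * \<delta>\<^sup>2)) \<longlongrightarrow> up + 0 * (um - up) / (min vm vp * \<delta>\<^sup>2)) (at_right 0)"
    using vm_pos vp_pos assms(1) by (intro tendsto_intros) auto
  then show U: "((\<lambda>\<epsilon>. u \<epsilon> (x \<epsilon>)) \<longlongrightarrow> up) (at_right 0)"
    by (intro tendsto_sandwich[OF ev'(1,2) tendsto_const]) simp
  have "((\<lambda>\<epsilon>. vp * exp ((u \<epsilon> (x \<epsilon>) ^ k - up ^ k) / \<delta>)) \<longlongrightarrow> vp * exp ((up ^ k - up ^ k) / \<delta>)) (at_right 0)"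
    using assms(1) by (intro tendsto_intros U) auto
  then show "((\<lambda>\<epsilon>. v \<epsilon> (x \<epsilon>)) \<longlongrightarrow> vp) (at_right 0)"
    by (intro tendsto_sandwich[OF ev'(3,4) tendsto_const]) simp
qed

lemma left_limits:
  assumes "\<delta> > 0" and x: "eventually (\<lambda>\<epsilon>. x \<epsilon> \<le> z \<epsilon> - \<delta>) (at_right 0)"
  shows "((\<lambda>\<epsilon>. u \<epsilon> (x \<epsilon>)) \<longlongrightarrow> um) (at_right 0)" "((\<lambda>\<epsilon>. v \<epsilon> (x \<epsilon>)) \<longlongrightarrow> vm) (at_right 0)"
proof -
  note ev = x eventually_at_right_less[of 0]
  have *: "um - \<epsilon> * (um - up) / (min vm vp * \<delta>\<^sup>2) \<le> u \<epsilon> (x \<epsilon>) \<and> u \<epsilon> (x \<epsilon>) \<le> um \<and>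
      vm \<le> v \<epsilon> (x \<epsilon>) \<and> v \<epsilon> (x \<epsilon>) \<le> vm * exp ((um ^ k - u \<epsilon> (x \<epsilon>) ^ k) / \<delta>)"
    if "x \<epsilon> \<le> z \<epsilon> - \<delta>" "\<epsilon> > 0" for \<epsilon>
  proof -
    interpret P: viscous_profile k \<epsilon> vm um vp up "v \<epsilon>" "u \<epsilon>" using that by (intro viscous_profileI)
    have zx: "x \<epsilon> < P.z" using that assms by simp
    have "(um ^ k - u \<epsilon> (x \<epsilon>) ^ k) / (P.z - x \<epsilon>) \<le> (um ^ k - u \<epsilon> (x \<epsilon>) ^ k) / \<delta>"
      using that assms P.u_power_range[of "x \<epsilon>"] by (intro divide_left_mono) auto
    then have "vm * exp ((um ^ k - u \<epsilon> (x \<epsilon>) ^ k) / (P.z - x \<epsilon>)) \<le> vm * exp ((um ^ k - u \<epsilon> (x \<epsilon>) ^ k) / \<delta>)"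
      using vm_pos by simp
    then show ?thesis
      using P.density_facts_left(1,2)[OF zx] P.u_range[of "x \<epsilon>"] P.u_antimono[OF that(1)] P.layer(4)[OF assms(1)]
      by auto
  qed
  have ev': "eventually (\<lambda>\<epsilon>. um - \<epsilon> * (um - up) / (min vm vp * \<delta>\<^sup>2) \<le> u \<epsilon> (x \<epsilon>)) (at_right 0)"
    "eventually (\<lambda>\<epsilon>. u \<epsilon> (x \<epsilon>) \<le> um) (at_right 0)"
    "eventually (\<lambda>\<epsilon>. vm \<le> v \<epsilon> (x \<epsilon>)) (at_right 0)"
    "eventually (\<lambda>\<epsilon>. v \<epsilon> (x \<epsilon>) \<le> vm * exp ((um ^ k - u \<epsilon> (x \<epsilon>) ^ k) / \<delta>)) (at_right 0)"
    by (use ev in eventually_elim, use * in blast)+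
  have "((\<lambda>\<epsilon>. um - \<epsilon> * (um - up) / (min vm vp * \<delta>\<^sup>2)) \<longlongrightarrow> um - 0 * (um - up) / (min vm vp * \<delta>\<^sup>2)) (at_right 0)"
    using vm_pos vp_pos assms(1) by (intro tendsto_intros) auto
  then show U: "((\<lambda>\<epsilon>. u \<epsilon> (x \<epsilon>)) \<longlongrightarrow> um) (at_right 0)"
    by (intro tendsto_sandwich[OF ev'(1,2) _ tendsto_const]) simp
  have "((\<lambda>\<epsilon>. vm * exp ((um ^ k - u \<epsilon> (x \<epsilon>) ^ k) / \<delta>)) \<longlongrightarrow> vm * exp ((um ^ k - um ^ k) / \<delta>)) (at_right 0)"
    using assms(1) by (intro tendsto_intros U) auto
  then show "((\<lambda>\<epsilon>. v \<epsilon> (x \<epsilon>)) \<longlongrightarrow> vm) (at_right 0)"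
    by (intro tendsto_sandwich[OF ev'(3,4) tendsto_const]) simp
qed

lemma eventually_z_range: "eventually (\<lambda>\<epsilon>. z \<epsilon> \<in> {up ^ k..um ^ k}) (at_right 0)"
  by (intro eventually_profile viscous_profile.z_range)

lemma eventually_u_z_range: "eventually (\<lambda>\<epsilon>. up \<le> u \<epsilon> (z \<epsilon>) \<and> u \<epsilon> (z \<epsilon>) \<le> um) (at_right 0)"
  by (rule eventually_profile) (use viscous_profile.u_range in fastforce)

text \<open>Convergence of \<open>z \<epsilon>\<close> is not yet available, so the comparison value
  moves with it. The boundedness of \<open>z \<epsilon>\<close> enters through \<open>K\<close>,
  which bounds the second factors \<open>up ^ k - z \<epsilon> - \<delta>\<close> and
  \<open>um ^ k - z \<epsilon> + \<delta>\<close> in absolute value.\<close>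

lemma flux_near_shock:
  assumes \<delta>: "\<delta> > 0"
  shows "((\<lambda>\<epsilon>. flux \<epsilon> (z \<epsilon> + \<delta>) - vp * (up ^ k - z \<epsilon> - \<delta>)) \<longlongrightarrow> 0) (at_right 0)" (is ?R)
    and "((\<lambda>\<epsilon>. flux \<epsilon> (z \<epsilon> - \<delta>) - vm * (um ^ k - z \<epsilon> + \<delta>)) \<longlongrightarrow> 0) (at_right 0)" (is ?L)
proof -
  define K where "K = um ^ k - up ^ k + \<delta>"
  note R = right_limits[OF \<delta>, of "\<lambda>\<epsilon>. z \<epsilon> + \<delta>", simplified]
  note L = left_limits[OF \<delta>, of "\<lambda>\<epsilon>. z \<epsilon> - \<delta>", simplified]
  have flux: "flux \<epsilon> x = v \<epsilon> x * (u \<epsilon> x ^ k - x)" if "\<epsilon> > 0" for \<epsilon> x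
    by (rule viscous_profile.flux_def[OF viscous_profileI[OF that]])
  show ?R
  proof (rule Lim_null_comparison)
    have bd: "\<bar>flux \<epsilon> (z \<epsilon> + \<delta>) - vp * (up ^ k - z \<epsilon> - \<delta>)\<bar>
      \<le> \<bar>v \<epsilon> (z \<epsilon> + \<delta>)\<bar> * \<bar>u \<epsilon> (z \<epsilon> + \<delta>) ^ k - up ^ k\<bar> + \<bar>v \<epsilon> (z \<epsilon> + \<delta>) - vp\<bar> * K"
      if "\<epsilon> > 0" "z \<epsilon> \<in> {up ^ k..um ^ k}" for \<epsilon>
    proof -
      have "flux \<epsilon> (z \<epsilon> + \<delta>) - vp * (up ^ k - z \<epsilon> - \<delta>)
        = v \<epsilon> (z \<epsilon> + \<delta>) * (u \<epsilon> (z \<epsilon> + \<delta>) ^ k - up ^ k) + (v \<epsilon> (z \<epsilon> + \<delta>) - vp) * (up ^ k - z \<epsilon> - \<delta>)"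
        unfolding flux[OF that(1)] by (simp add: algebra_simps)
      moreover have "\<bar>(v \<epsilon> (z \<epsilon> + \<delta>) - vp) * (up ^ k - z \<epsilon> - \<delta>)\<bar> \<le> \<bar>v \<epsilon> (z \<epsilon> + \<delta>) - vp\<bar> * K"
        unfolding abs_mult using that \<delta> by (intro mult_left_mono) (auto simp: K_def)
      ultimately show ?thesis unfolding abs_mult[symmetric] by linarith
    qed
    show "eventually (\<lambda>\<epsilon>. norm (flux \<epsilon> (z \<epsilon> + \<delta>) - vp * (up ^ k - z \<epsilon> - \<delta>))
      \<le> \<bar>v \<epsilon> (z \<epsilon> + \<delta>)\<bar> * \<bar>u \<epsilon> (z \<epsilon> + \<delta>) ^ k - up ^ k\<bar> + \<bar>v \<epsilon> (z \<epsilon> + \<delta>) - vp\<bar> * K) (at_right 0)"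
      using eventually_at_right_less[of 0] eventually_z_range
      by eventually_elim (simp only: real_norm_def bd)
    have "((\<lambda>\<epsilon>. \<bar>v \<epsilon> (z \<epsilon> + \<delta>)\<bar> * \<bar>u \<epsilon> (z \<epsilon> + \<delta>) ^ k - up ^ k\<bar> + \<bar>v \<epsilon> (z \<epsilon> + \<delta>) - vp\<bar> * K)
      \<longlongrightarrow> \<bar>vp\<bar> * \<bar>up ^ k - up ^ k\<bar> + \<bar>vp - vp\<bar> * K) (at_right 0)"
      by (intro tendsto_intros R)
    then show "((\<lambda>\<epsilon>. \<bar>v \<epsilon> (z \<epsilon> + \<delta>)\<bar> * \<bar>u \<epsilon> (z \<epsilon> + \<delta>) ^ k - up ^ k\<bar> + \<bar>v \<epsilon> (z \<epsilon> + \<delta>) - vp\<bar> * K)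
      \<longlongrightarrow> 0) (at_right 0)" by simp
  qed
  show ?L
  proof (rule Lim_null_comparison)
    have bd: "\<bar>flux \<epsilon> (z \<epsilon> - \<delta>) - vm * (um ^ k - z \<epsilon> + \<delta>)\<bar>
      \<le> \<bar>v \<epsilon> (z \<epsilon> - \<delta>)\<bar> * \<bar>u \<epsilon> (z \<epsilon> - \<delta>) ^ k - um ^ k\<bar> + \<bar>v \<epsilon> (z \<epsilon> - \<delta>) - vm\<bar> * K"
      if "\<epsilon> > 0" "z \<epsilon> \<in> {up ^ k..um ^ k}" for \<epsilon>
    proof -
      have "flux \<epsilon> (z \<epsilon> - \<delta>) - vm * (um ^ k - z \<epsilon> + \<delta>)
        = v \<epsilon> (z \<epsilon> - \<delta>) * (u \<epsilon> (z \<epsilon> - \<delta>) ^ k - um ^ k) + (v \<epsilon> (z \<epsilon> - \<delta>) - vm) * (um ^ k - z \<epsilon> + \<delta>)"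
        unfolding flux[OF that(1)] by (simp add: algebra_simps)
      moreover have "\<bar>(v \<epsilon> (z \<epsilon> - \<delta>) - vm) * (um ^ k - z \<epsilon> + \<delta>)\<bar> \<le> \<bar>v \<epsilon> (z \<epsilon> - \<delta>) - vm\<bar> * K"
        unfolding abs_mult using that \<delta> by (intro mult_left_mono) (auto simp: K_def)
      ultimately show ?thesis unfolding abs_mult[symmetric] by linarith
    qed
    show "eventually (\<lambda>\<epsilon>. norm (flux \<epsilon> (z \<epsilon> - \<delta>) - vm * (um ^ k - z \<epsilon> + \<delta>))
      \<le> \<bar>v \<epsilon> (z \<epsilon> - \<delta>)\<bar> * \<bar>u \<epsilon> (z \<epsilon> - \<delta>) ^ k - um ^ k\<bar> + \<bar>v \<epsilon> (z \<epsilon> - \<delta>) - vm\<bar> * K) (at_right 0)"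
      using eventually_at_right_less[of 0] eventually_z_range
      by eventually_elim (simp only: real_norm_def bd)
    have "((\<lambda>\<epsilon>. \<bar>v \<epsilon> (z \<epsilon> - \<delta>)\<bar> * \<bar>u \<epsilon> (z \<epsilon> - \<delta>) ^ k - um ^ k\<bar> + \<bar>v \<epsilon> (z \<epsilon> - \<delta>) - vm\<bar> * K)
      \<longlongrightarrow> \<bar>vm\<bar> * \<bar>um ^ k - um ^ k\<bar> + \<bar>vm - vm\<bar> * K) (at_right 0)"
      by (intro tendsto_intros L)
    then show "((\<lambda>\<epsilon>. \<bar>v \<epsilon> (z \<epsilon> - \<delta>)\<bar> * \<bar>u \<epsilon> (z \<epsilon> - \<delta>) ^ k - um ^ k\<bar> + \<bar>v \<epsilon> (z \<epsilon> - \<delta>) - vm\<bar> * K)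
      \<longlongrightarrow> 0) (at_right 0)" by simp
  qed
qed

lemma shock_defect_tendsto_0:
  "((\<lambda>\<epsilon>. shock_defect k vm um vp up (u \<epsilon> (z \<epsilon>))) \<longlongrightarrow> 0) (at_right 0)"
proof (rule tendstoI)
  fix e :: real assume e: "e > 0"
  define J where "J = um - up"
  \<comment> \<open>The 1 in \<open>K\<close> pays for \<delta> \<le> 1. \<open>M\<close> bounds the
    drop of the flux across the window: \<open>(vm + vp) * K\<close> for its limiting values and 1
    for the error.\<close>
  define K where "K = um ^ k - up ^ k + 1"
  define M where "M = (vm + vp) * K + 1"
  have "up ^ k < um ^ k" using up_less_um odd_k by (simp add: power_less_odd_iff)
  then have JK: "J > 0" "K > 0" using up_less_um by (auto simp: J_def K_def)
  have M: "M > 0" unfolding M_def using vm_pos vp_pos JK by (simp add: add_pos_pos)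
  \<comment> \<open>\<open>C\<close> depends on \<eta> and may be huge, so \<eta> is fixed using
    only \<open>M\<close>, and \<delta> is chosen afterwards, small against
    \<open>C\<close>.\<close>
  define \<eta> where "\<eta> = e / (4 * M)"
  have \<eta>: "\<eta> > 0" using e M by (simp add: \<eta>_def)
  obtain C where C: "C > 0" "\<And>x y. x \<in> {up..um} \<Longrightarrow> y \<in> {up..um} \<Longrightarrow> \<bar>x - y\<bar> \<le> \<eta> + C * \<bar>x ^ k - y ^ k\<bar>"
    using dist_le_power_dist[OF odd_k \<eta>] by metis
  \<comment> \<open>\<open>B\<close> gathers the coefficients of \<delta>: \<open>3 * C * M\<close>
    from the momentum balance and \<open>(vm + vp) * J\<close> from the shift by \<delta> in the
    limiting fluxes.\<close>
  define B where "B = 3 * C * M + (vm + vp) * J + 1"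
  have B: "B > 0" unfolding B_def using C(1) M vm_pos vp_pos JK by (simp add: add_pos_pos)
  define \<delta> where "\<delta> = min 1 (e / (4 * B))"
  have \<delta>: "\<delta> > 0" "\<delta> \<le> 1" and "\<delta> \<le> e / (4 * B)" using e B by (auto simp: \<delta>_def)
  then have \<delta>B: "\<delta> * B \<le> e / 4" using B by (simp add: field_simps)
  define fa where "fa \<epsilon> = flux \<epsilon> (z \<epsilon> - \<delta>)" for \<epsilon>
  define fb where "fb \<epsilon> = flux \<epsilon> (z \<epsilon> + \<delta>)" for \<epsilon>
  define A where "A \<epsilon> = vm * (um ^ k - z \<epsilon> + \<delta>)" for \<epsilon>
  define A' where "A' \<epsilon> = vp * (up ^ k - z \<epsilon> - \<delta>)" for \<epsilon>
  \<comment> \<open>This collects the errors that vanish with \<epsilon> at fixed \<delta>: fluxes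
    and velocities at the window ends replaced by their limiting values, and the viscous
    term.\<close>
  define r where "r \<epsilon> = \<bar>fa \<epsilon> - A \<epsilon>\<bar> * J + vm * K * \<bar>u \<epsilon> (z \<epsilon> - \<delta>) - um\<bar>
      + \<bar>fb \<epsilon> - A' \<epsilon>\<bar> * J + vp * K * \<bar>u \<epsilon> (z \<epsilon> + \<delta>) - up\<bar> + \<epsilon> * (2 * (J / \<delta>))" for \<epsilon>
  have nulls: "((\<lambda>\<epsilon>. fb \<epsilon> - A' \<epsilon>) \<longlongrightarrow> 0) (at_right 0)" "((\<lambda>\<epsilon>. fa \<epsilon> - A \<epsilon>) \<longlongrightarrow> 0) (at_right 0)"
    using flux_near_shock[OF \<delta>(1)] by (auto simp: fa_def fb_def A_def A'_def)
  have "(r \<longlongrightarrow> \<bar>0\<bar> * J + vm * K * \<bar>um - um\<bar> + \<bar>0\<bar> * J + vp * K * \<bar>up - up\<bar> + 0 * (2 * (J / \<delta>))) (at_right 0)"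
    unfolding r_def
    by (intro tendsto_intros nulls right_limits(1)[OF \<delta>(1)] left_limits(1)[OF \<delta>(1)] always_eventually) auto
  then have "(r \<longlongrightarrow> 0) (at_right 0)" by simp
  then have "eventually (\<lambda>\<epsilon>. r \<epsilon> < e / 4) (at_right 0)"
    using e by (intro order_tendstoD) auto
  moreover have "((\<lambda>\<epsilon>. \<bar>fa \<epsilon> - A \<epsilon>\<bar> + \<bar>fb \<epsilon> - A' \<epsilon>\<bar>) \<longlongrightarrow> \<bar>0\<bar> + \<bar>0\<bar>) (at_right 0)"
    by (intro tendsto_intros nulls)
  then have "eventually (\<lambda>\<epsilon>. \<bar>fa \<epsilon> - A \<epsilon>\<bar> + \<bar>fb \<epsilon> - A' \<epsilon>\<bar> < 1) (at_right 0)"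
    by (intro order_tendstoD) auto
  ultimately show "eventually (\<lambda>\<epsilon>. dist (shock_defect k vm um vp up (u \<epsilon> (z \<epsilon>))) 0 < e) (at_right 0)"
    using eventually_at_right_less[of 0]
  proof eventually_elim
    case (elim \<epsilon>)
    interpret P: viscous_profile k \<epsilon> vm um vp up "v \<epsilon>" "u \<epsilon>" using elim by (intro viscous_profileI)
    define d where "d = u \<epsilon> P.z"
    define a where "a = P.z - \<delta>"
    define b where "b = P.z + \<delta>"
    have d: "d \<in> {up..um}" "P.z = d ^ k" "up ^ k \<le> d ^ k" "d ^ k \<le> um ^ k"
      using P.u_range[of P.z] P.fixed_point P.z_range by (auto simp: d_def)
    have A: "0 \<le> A \<epsilon>" "A \<epsilon> \<le> vm * K" and A': "A' \<epsilon> \<le> 0" "- A' \<epsilon> \<le> vp * K"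
    proof -
      have "- A' \<epsilon> = vp * (P.z + \<delta> - up ^ k)" by (simp add: A'_def algebra_simps)
      moreover have "vp * (P.z + \<delta> - up ^ k) \<le> vp * K" "0 \<le> vp * (P.z + \<delta> - up ^ k)"
        using d \<delta> vp_pos by (auto simp: K_def)
      ultimately show "A' \<epsilon> \<le> 0" "- A' \<epsilon> \<le> vp * K" by linarith+
      show "0 \<le> A \<epsilon>" "A \<epsilon> \<le> vm * K" using d \<delta> vm_pos by (auto simp: A_def K_def)
    qed
    define T where "T = fa \<epsilon> * (u \<epsilon> a - d) - fb \<epsilon> * (u \<epsilon> b - d) + \<epsilon> * (deriv (u \<epsilon>) b - deriv (u \<epsilon>) a)"
    have fM: "fa \<epsilon> - fb \<epsilon> \<le> M" using elim(2) A A' by (simp add: M_def algebra_simps)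
    have "\<bar>T\<bar> \<le> (\<eta> + 3 * C * \<delta>) * (fa \<epsilon> - fb \<epsilon>)"
      unfolding T_def a_def b_def d_def fa_def fb_def
      using \<delta>(1) \<eta> C by (intro P.momentum_balance) auto
    also have "\<dots> \<le> (\<eta> + 3 * C * \<delta>) * M"
      using \<delta>(1) \<eta> C fM by (intro mult_left_mono) auto
    also have "\<dots> = e / 4 + \<delta> * (3 * C * M)" using M by (simp add: \<eta>_def distrib_right)
    finally have T: "\<bar>T\<bar> \<le> e / 4 + \<delta> * (3 * C * M)" .
    \<comment> \<open>\<open>S\<close> is \<open>T\<close> with limiting fluxes and end states and
      without viscosity; up to a term of order \<delta> it is minus the defect. All errors together
      stay below \<open>3 * e / 4\<close>.\<close>
    define S where "S = A \<epsilon> * (um - d) - A' \<epsilon> * (up - d)"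
    have TS: "T - S = (fa \<epsilon> - A \<epsilon>) * (u \<epsilon> a - d) + A \<epsilon> * (u \<epsilon> a - um)
        - (fb \<epsilon> - A' \<epsilon>) * (u \<epsilon> b - d) - A' \<epsilon> * (u \<epsilon> b - up)
        + \<epsilon> * (deriv (u \<epsilon>) b - deriv (u \<epsilon>) a)"
      unfolding T_def S_def by (simp add: algebra_simps)
    have t1: "\<bar>(fa \<epsilon> - A \<epsilon>) * (u \<epsilon> a - d)\<bar> \<le> \<bar>fa \<epsilon> - A \<epsilon>\<bar> * J"
      unfolding abs_mult using d P.u_range[of a] by (intro mult_left_mono) (auto simp: J_def)
    have t2: "\<bar>(fb \<epsilon> - A' \<epsilon>) * (u \<epsilon> b - d)\<bar> \<le> \<bar>fb \<epsilon> - A' \<epsilon>\<bar> * J"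
      unfolding abs_mult using d P.u_range[of b] by (intro mult_left_mono) (auto simp: J_def)
    have t3: "\<bar>A \<epsilon> * (u \<epsilon> a - um)\<bar> \<le> vm * K * \<bar>u \<epsilon> a - um\<bar>"
      unfolding abs_mult using A by (intro mult_right_mono) auto
    have t4: "\<bar>A' \<epsilon> * (u \<epsilon> b - up)\<bar> \<le> vp * K * \<bar>u \<epsilon> b - up\<bar>"
      unfolding abs_mult using A' by (intro mult_right_mono) auto
    have t5: "\<bar>\<epsilon> * (deriv (u \<epsilon>) b - deriv (u \<epsilon>) a)\<bar> \<le> \<epsilon> * (2 * (J / \<delta>))"
      unfolding abs_mult using P.layer(1,2)[OF \<delta>(1)] elim(3) unfolding J_def a_def b_def
      by (intro mult_mono) linarith+
    have tri: "\<bar>x1 + x2 - x3 - x4 + x5\<bar> \<le> \<bar>x1\<bar> + \<bar>x2\<bar> + \<bar>x3\<bar> + \<bar>x4\<bar> + \<bar>x5\<bar>" for x1 x2 x3 x4 x5 :: real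
      by linarith
    have "\<bar>T - S\<bar> \<le> r \<epsilon>"
      unfolding r_def a_def[symmetric] b_def[symmetric] TS
      by (intro order_trans[OF tri] add_mono t1 t2 t3 t4 t5)
    moreover have "\<bar>S + shock_defect k vm um vp up d\<bar> \<le> \<delta> * ((vm + vp) * J)"
    proof -
      have "S + shock_defect k vm um vp up d = \<delta> * (vm * (um - d) - vp * (d - up))"
        unfolding S_def A_def A'_def shock_defect_def d(2)[symmetric] by (simp add: algebra_simps)
      also have "\<bar>\<dots>\<bar> = \<delta> * \<bar>vm * (um - d) - vp * (d - up)\<bar>" using \<delta>(1) by (simp add: abs_mult)
      also have "\<bar>vm * (um - d) - vp * (d - up)\<bar> \<le> (vm + vp) * J"
      proof -
        have "0 \<le> vm * (um - d)" "vm * (um - d) \<le> vm * J" "0 \<le> vp * (d - up)" "vp * (d - up) \<le> vp * J"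
          using d vm_pos vp_pos by (auto simp: J_def)
        then show ?thesis unfolding distrib_right by linarith
      qed
      finally show ?thesis using \<delta>(1) by simp
    qed
    moreover have "\<delta> * (3 * C * M) + \<delta> * ((vm + vp) * J) \<le> \<delta> * B"
      unfolding B_def using \<delta>(1) by (simp add: distrib_left)
    ultimately have "\<bar>shock_defect k vm um vp up d\<bar> < e"
      using T \<delta>B elim(1) e by linarith
    then show ?case by (simp add: d_def)
  qed
qed

end

subsection \<open>Test functions and half-line integrals\<close>

lemma smooth_continuous: "smooth f \<Longrightarrow> continuous_on A (iterated_derivative hs f)"
  unfolding smooth_def
  by (meson continuous_at_imp_continuous_on differentiable_imp_continuous_within)

lemma test_function_real:
  fixes \<psi> :: "real \<Rightarrow> real"
  assumes "test_function UNIV \<psi>"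
  obtains R where "R > 0" "continuous_on UNIV \<psi>" "\<And>x. x \<notin> {-R..R} \<Longrightarrow> \<psi> x = 0"
proof -
  have "smooth \<psi>" and K: "compact (closure {z. \<psi> z \<noteq> 0})" using assms by (auto simp: test_function_def)
  from smooth_continuous[OF this(1), of _ "[]"] have c: "continuous_on UNIV \<psi>" by simp
  obtain R where R: "R > 0" "\<And>x. x \<in> closure {z. \<psi> z \<noteq> 0} \<Longrightarrow> \<bar>x\<bar> \<le> R"
    using compact_imp_bounded[OF K] unfolding bounded_pos by auto
  show thesis
  proof (rule that[OF R(1) c])
    fix x assume "x \<notin> {-R..R}"
    then have "x \<notin> closure {z. \<psi> z \<noteq> 0}" using R(2)[of x] by auto
    then show "\<psi> x = 0" using closure_subset[of "{z. \<psi> z \<noteq> 0}"] by auto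
  qed
qed

lemma continuous_box_support_bounded:
  fixes f :: "real \<times> real \<Rightarrow> real"
  assumes "continuous_on UNIV f" and supp: "\<And>x t. x \<notin> {a..b} \<or> t \<notin> {c..d} \<Longrightarrow> f (x, t) = 0"
  shows "\<exists>B. \<forall>p. \<bar>f p\<bar> \<le> B"
proof -
  have "bounded (f ` ({a..b} \<times> {c..d}))"
    using assms(1) by (intro compact_imp_bounded compact_continuous_image compact_Times compact_Icc)
      (auto intro: continuous_on_subset)
  then obtain B where B: "B > 0" "\<And>p. p \<in> {a..b} \<times> {c..d} \<Longrightarrow> \<bar>f p\<bar> \<le> B"
    unfolding bounded_pos by auto
  have "\<bar>f p\<bar> \<le> B" for p
    using B supp[of "fst p" "snd p"] by (cases "p \<in> {a..b} \<times> {c..d}") (auto simp: mem_Times_iff)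
  then show ?thesis by blast
qed

text \<open>What is used of a test function: a total derivative with named partials, for the chain
  rule along curves, and a support box with \<open>t \<ge> t0 > 0\<close>, which keeps integrals
  away from the singular time 0 and lets them run over all times.\<close>

locale plane_test =
  fixes \<phi> \<phi>x \<phi>t :: "real \<times> real \<Rightarrow> real" and t0 R :: real
  assumes t0_pos: "t0 > 0" and R_pos: "R > 0"
    and cont: "continuous_on A \<phi>" "continuous_on A \<phi>x" "continuous_on A \<phi>t"
    and deriv: "(\<phi> has_derivative (\<lambda>h. fst h * \<phi>x p + snd h * \<phi>t p)) (at p)"
    and vanish: "x \<notin> {-R..R} \<or> t \<notin> {t0..R} \<Longrightarrow> \<phi> (x, t) = 0 \<and> \<phi>x (x, t) = 0 \<and> \<phi>t (x, t) = 0"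
begin

lemma DERIV_curve:
  assumes "(a has_real_derivative a') (at s)" "(b has_real_derivative b') (at s)"
  shows "((\<lambda>s. \<phi> (a s, b s)) has_real_derivative a' * \<phi>x (a s, b s) + b' * \<phi>t (a s, b s)) (at s)"
proof -
  have "((\<lambda>s. (a s, b s)) has_derivative (\<lambda>h. (h * a', h * b'))) (at s)"
    using assms by (intro has_derivative_Pair) (simp_all add: has_field_derivative_def mult_commute_abs)
  from has_derivative_compose[OF this deriv]
  moreover have "(\<lambda>h. fst (h * a', h * b') * \<phi>x (a s, b s) + snd (h * a', h * b') * \<phi>t (a s, b s))
      = (*) (a' * \<phi>x (a s, b s) + b' * \<phi>t (a s, b s))"
    by (auto simp: algebra_simps)
  ultimately show ?thesis by (simp only: has_field_derivative_def)
qed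

lemma bound:
  obtains B where "B > 0" "\<And>p. \<bar>\<phi> p\<bar> \<le> B" "\<And>p. \<bar>\<phi>x p\<bar> \<le> B" "\<And>p. \<bar>\<phi>t p\<bar> \<le> B"
proof -
  note bnd = continuous_box_support_bounded[where a = "- R" and b = R and c = t0 and d = R]
  obtain B1 where B1: "\<bar>\<phi> p\<bar> \<le> B1" for p using bnd[OF cont(1)] vanish by blast
  obtain B2 where B2: "\<bar>\<phi>x p\<bar> \<le> B2" for p using bnd[OF cont(2)] vanish by blast
  obtain B3 where B3: "\<bar>\<phi>t p\<bar> \<le> B3" for p using bnd[OF cont(3)] vanish by blast
  have "0 \<le> B1" "0 \<le> B2" "0 \<le> B3"
    using order_trans[OF abs_ge_zero B1] order_trans[OF abs_ge_zero B2] order_trans[OF abs_ge_zero B3] by auto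
  note nonneg = this
  show thesis
  proof (rule that[of "B1 + B2 + B3 + 1"])
    show "\<bar>\<phi> p\<bar> \<le> B1 + B2 + B3 + 1" for p using B1[of p] nonneg by linarith
    show "\<bar>\<phi>x p\<bar> \<le> B1 + B2 + B3 + 1" for p using B2[of p] nonneg by linarith
    show "\<bar>\<phi>t p\<bar> \<le> B1 + B2 + B3 + 1" for p using B3[of p] nonneg by linarith
  qed (use nonneg in linarith)
qed

end

text \<open>The support is compact in the open half plane, so time has a positive minimum on it
  unless it is empty. The partial derivatives are the values of the total derivative on the unit
  vectors.\<close>

lemma test_function_half_plane:
  assumes "test_function half_plane \<phi>"
  obtains t0 R where "plane_test \<phi> (deriv_x \<phi>) (deriv_t \<phi>) t0 R"
proof -
  define K where "K = closure {z. \<phi> z \<noteq> 0}"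
  have sm: "smooth \<phi>" and K: "compact K" "K \<subseteq> half_plane"
    using assms by (auto simp: test_function_def K_def)
  have D: "(\<phi> has_derivative frechet_derivative \<phi> (at p)) (at p)" for p
    using sm unfolding smooth_def by (metis frechet_derivative_works iterated_derivative.simps(1))
  have lin: "linear (frechet_derivative \<phi> (at p))" for p
    using D by (rule has_derivative_linear)
  have split: "frechet_derivative \<phi> (at p) h
    = fst h * frechet_derivative \<phi> (at p) (1, 0) + snd h * frechet_derivative \<phi> (at p) (0, 1)" for p h
  proof -
    have "h = fst h *\<^sub>R (1, 0) + snd h *\<^sub>R (0, 1)" by (simp add: prod_eq_iff)
    then show ?thesis
      using linear_add[OF lin[of p], of "fst h *\<^sub>R (1, 0)" "snd h *\<^sub>R (0, 1)"]
        linear_scale[OF lin[of p], of "fst h" "(1, 0)"] linear_scale[OF lin[of p], of "snd h" "(0, 1)"]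
      by simp
  qed
  have sx: "(*) (frechet_derivative \<phi> (at p) (1, 0)) = (\<lambda>h. frechet_derivative \<phi> (at p) (h, 0))"
    and st: "(*) (frechet_derivative \<phi> (at p) (0, 1)) = (\<lambda>h. frechet_derivative \<phi> (at p) (0, h))" for p
    by (rule ext, subst (2) split, simp)+
  have dx: "deriv_x \<phi> p = frechet_derivative \<phi> (at p) (1, 0)" for p
  proof (cases p)
    case (Pair x t)
    have "((\<lambda>y. (y, t)) has_derivative (\<lambda>h. (h, 0))) (at x)"
      by (auto intro!: derivative_eq_intros)
    from has_derivative_compose[OF this D]
    have "((\<lambda>y. \<phi> (y, t)) has_real_derivative frechet_derivative \<phi> (at p) (1, 0)) (at x)"
      unfolding Pair sx has_field_derivative_def mult_commute_abs .
    then show ?thesis by (simp add: deriv_x_def Pair DERIV_imp_deriv)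
  qed
  have dt: "deriv_t \<phi> p = frechet_derivative \<phi> (at p) (0, 1)" for p
  proof (cases p)
    case (Pair x t)
    have "((\<lambda>s. (x, s)) has_derivative (\<lambda>h. (0, h))) (at t)"
      by (auto intro!: derivative_eq_intros)
    from has_derivative_compose[OF this D]
    have "((\<lambda>s. \<phi> (x, s)) has_real_derivative frechet_derivative \<phi> (at p) (0, 1)) (at t)"
      unfolding Pair st has_field_derivative_def mult_commute_abs .
    then show ?thesis by (simp add: deriv_t_def Pair DERIV_imp_deriv)
  qed
  have van: "\<phi> p = 0 \<and> deriv_x \<phi> p = 0 \<and> deriv_t \<phi> p = 0" if "p \<notin> K" for p
  proof -
    have z: "\<phi> q = 0" if "q \<in> - K" for q
      using that closure_subset[of "{z. \<phi> z \<noteq> 0}"] by (auto simp: K_def)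
    have "(\<phi> has_derivative (\<lambda>_. 0)) (at p)"
    proof (rule has_derivative_transform_within_open[OF has_derivative_const])
      show "open (- K)" by (simp add: K_def open_Compl)
      show "p \<in> - K" using that by simp
      show "0 = \<phi> q" if "q \<in> - K" for q using z[OF that] by simp
    qed
    then have "frechet_derivative \<phi> (at p) = (\<lambda>_. 0)" by (rule frechet_derivative_at[symmetric])
    then show ?thesis using z that by (simp add: dx dt)
  qed
  obtain R where R: "R > 0" "\<And>p. p \<in> K \<Longrightarrow> norm p \<le> R"
    using compact_imp_bounded[OF K(1)] unfolding bounded_pos by auto
  have "\<exists>t0>0. \<forall>p\<in>K. t0 \<le> snd p"
  proof (cases "K = {}")
    case False
    have "continuous_on K snd" by (intro continuous_intros)
    then obtain q where "q \<in> K" "\<And>p. p \<in> K \<Longrightarrow> snd q \<le> snd p"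
      using continuous_attains_inf[OF K(1) False] by blast
    then show ?thesis using K(2) by (intro exI[of _ "snd q"]) (auto simp: half_plane_def)
  qed (auto intro: exI[of _ 1])
  then obtain t0 where t0: "t0 > 0" "\<And>p. p \<in> K \<Longrightarrow> t0 \<le> snd p" by blast
  show thesis
  proof (rule that, unfold_locales)
    show "t0 > 0" "R > 0" using t0 R by auto
    show "continuous_on A \<phi>" "continuous_on A (deriv_x \<phi>)" "continuous_on A (deriv_t \<phi>)" for A
      using smooth_continuous[OF sm, of A "[]"] smooth_continuous[OF sm, of A "[(1, 0)]"]
        smooth_continuous[OF sm, of A "[(0, 1)]"] by (simp_all add: dx[abs_def] dt[abs_def])
    show "(\<phi> has_derivative (\<lambda>h. fst h * deriv_x \<phi> p + snd h * deriv_t \<phi> p)) (at p)" for p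
    proof -
      have "frechet_derivative \<phi> (at p) = (\<lambda>h. fst h * deriv_x \<phi> p + snd h * deriv_t \<phi> p)"
        unfolding dx dt by (rule ext, rule split)
      with D[of p] show ?thesis by (simp only:)
    qed
    fix x t assume xt: "x \<notin> {-R..R} \<or> t \<notin> {t0..R}"
    have "(x, t) \<notin> K"
    proof
      assume a: "(x, t) \<in> K"
      have "\<bar>x\<bar> \<le> norm (x, t)" "\<bar>t\<bar> \<le> norm (x, t)"
        using norm_fst_le[of x t] norm_snd_le[of t x] by simp_all
      then show False using xt R(2)[OF a] t0(2)[OF a] by auto
    qed
    from van[OF this] show "\<phi> (x, t) = 0 \<and> deriv_x \<phi> (x, t) = 0 \<and> deriv_t \<phi> (x, t) = 0" .
  qed
qed

section \<open>Integrals over half lines and over moving regions\<close>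

lemma integrable_bounded_support:
  fixes f :: "real \<Rightarrow> real"
  assumes "f \<in> borel_measurable borel" "\<And>x. \<bar>f x\<bar> \<le> B" "\<And>x. x \<notin> {a..b} \<Longrightarrow> f x = 0"
  shows "integrable lborel f"
proof (rule Bochner_Integration.integrable_bound)
  show "integrable lborel (\<lambda>x. indicator {a..b} x * B)"
    by (intro integrable_mult_left integrable_real_indicator) (auto simp: emeasure_lborel_Icc_eq)
  show "AE x in lborel. norm (f x) \<le> norm (indicator {a..b} x * B)"
  proof (intro AE_I2)
    fix x
    show "norm (f x) \<le> norm (indicator {a..b} x * B)"
      using assms(2)[of x] assms(3)[of x] abs_ge_self[of B]
      by (cases "x \<in> {a..b}") (auto simp del: abs_ge_self)
  qed
qed (use assms in simp)

lemma integrable_continuous_support: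
  fixes f :: "real \<Rightarrow> real"
  assumes "continuous_on UNIV f" "\<And>x. x \<notin> {a..b} \<Longrightarrow> f x = 0"
  shows "integrable lborel f"
proof -
  have "bounded (f ` {a..b})"
    using assms(1) by (intro compact_imp_bounded compact_continuous_image) (auto intro: continuous_on_subset)
  then obtain B where B: "B > 0" "\<And>x. x \<in> {a..b} \<Longrightarrow> \<bar>f x\<bar> \<le> B" unfolding bounded_pos by auto
  have "\<bar>f x\<bar> \<le> B" for x using B assms(2)[of x] by (cases "x \<in> {a..b}") auto
  then show ?thesis
    using assms by (intro integrable_bounded_support[of f B a b] borel_measurable_continuous_onI) auto
qed

lemma half_line_FTC:
  fixes g g' :: "real \<Rightarrow> real"
  assumes D: "\<And>x. (g has_real_derivative g' x) (at x)" and c: "continuous_on UNIV g'"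
    and supp: "\<And>x. x \<notin> {-R..R} \<Longrightarrow> g x = 0 \<and> g' x = 0"
  shows "(LBINT x:{..<X}. g' x) = g X" "(LBINT x:{X<..}. g' x) = - g X"
proof -
  \<comment> \<open>A window with the support and \<open>X\<close> in its interior, so that
    \<open>g\<close> vanishes at its outer end points.\<close>
  define L where "L = max \<bar>R\<bar> \<bar>X\<bar> + 1"
  have RL: "\<bar>R\<bar> < L" "\<bar>X\<bar> < L" by (auto simp: L_def max_def)
  have out: "g x = 0 \<and> g' x = 0" if "L \<le> \<bar>x\<bar>" for x
    using that RL by (intro supp) auto
  have L: "- L < X" "X < L" "g (- L) = 0" "g L = 0" using out[of L] out[of "- L"] RL by auto
  have [measurable]: "g' \<in> borel_measurable borel" using c by (rule borel_measurable_continuous_onI)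
  have D': "(g has_vector_derivative g' x) (at x within A)" for x A
    by (rule has_vector_derivative_at_within, rule D[unfolded has_real_derivative_iff_has_vector_derivative])
  have "(LBINT x:{..<X}. g' x) = (LBINT x. indicator {- L..X} x *\<^sub>R g' x)"
    unfolding set_lebesgue_integral_def
  proof (intro integral_cong_AE)
    show "AE x in lborel. indicator {..<X} x *\<^sub>R g' x = indicator {- L..X} x *\<^sub>R g' x"
      using AE_lborel_singleton[of X]
    proof eventually_elim
      case (elim x)
      then show ?case using out[of x] by (cases "L \<le> \<bar>x\<bar>") (auto simp: indicator_def)
    qed
  qed measurable
  also have "\<dots> = g X - g (- L)"
    using L by (intro integral_FTC_atLeastAtMost D' continuous_on_subset[OF c]) auto
  finally show "(LBINT x:{..<X}. g' x) = g X" using L by simp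
  have "(LBINT x:{X<..}. g' x) = (LBINT x. indicator {X..L} x *\<^sub>R g' x)"
    unfolding set_lebesgue_integral_def
  proof (intro integral_cong_AE)
    show "AE x in lborel. indicator {X<..} x *\<^sub>R g' x = indicator {X..L} x *\<^sub>R g' x"
      using AE_lborel_singleton[of X]
    proof eventually_elim
      case (elim x)
      then show ?case using out[of x] by (cases "L \<le> \<bar>x\<bar>") (auto simp: indicator_def)
    qed
  qed measurable
  also have "\<dots> = g L - g X"
    using L by (intro integral_FTC_atLeastAtMost D' continuous_on_subset[OF c]) auto
  finally show "(LBINT x:{X<..}. g' x) = - g X" using L by simp
qed

text \<open>The value of \<open>s\<close> at the jump is arbitrary, so a velocity equal to
  \<open>ud\<close> on the curve is covered; measurability of \<open>s\<close> follows from the step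
  form.\<close>

lemma step_integral:
  fixes h :: "real \<Rightarrow> real"
  assumes "integrable lborel h" and s: "\<And>x. x < X \<Longrightarrow> s x = a" "\<And>x. x > X \<Longrightarrow> s x = b"
  shows "(LBINT x. s x * h x) = a * (LBINT x:{..<X}. h x) + b * (LBINT x:{X<..}. h x)"
proof -
  have i: "integrable lborel (\<lambda>x. indicator A x * h x)" if "A \<in> sets borel" for A
    using integrable_mult_indicator[of A lborel h] assms(1) that by simp
  have [measurable]: "h \<in> borel_measurable borel" using borel_measurable_integrable[OF assms(1)] by simp
  have "s = (\<lambda>x. if x < X then a else if x = X then s X else b)" using s by (intro ext) auto
  moreover have "(\<lambda>x. if x < X then a else if x = X then s X else b) \<in> borel_measurable borel" by measurable
  ultimately have [measurable]: "s \<in> borel_measurable borel" by metis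
  have "(LBINT x. s x * h x) = (LBINT x. a * (indicator {..<X} x * h x) + b * (indicator {X<..} x * h x))"
  proof (intro integral_cong_AE)
    show "AE x in lborel. s x * h x = a * (indicator {..<X} x * h x) + b * (indicator {X<..} x * h x)"
      using AE_lborel_singleton[of X]
    proof eventually_elim
      case (elim x)
      then show ?case using s[of x] by (cases "x < X") auto
    qed
  qed measurable
  also have "\<dots> = a * (LBINT x:{..<X}. h x) + b * (LBINT x:{X<..}. h x)"
    unfolding set_lebesgue_integral_def using i by simp
  finally show ?thesis .
qed

lemma set_integral_eq_integral:
  fixes f :: "real \<Rightarrow> real"
  assumes "\<And>t. t \<notin> A \<Longrightarrow> f t = 0"
  shows "(LBINT t:A. f t) = (LBINT t. f t)"
  unfolding set_lebesgue_integral_def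
  using assms by (intro Bochner_Integration.integral_cong) (auto simp: indicator_def)

lemma integral_derivative_eq_0:
  fixes g g' :: "real \<Rightarrow> real"
  assumes D: "\<And>x. (g has_real_derivative g' x) (at x)" and c: "continuous_on UNIV g'"
    and supp: "\<And>x. x \<notin> {-R..R} \<Longrightarrow> g x = 0 \<and> g' x = 0"
  shows "(LBINT x. g' x) = 0"
proof -
  have "integrable lborel g'" using supp by (intro integrable_continuous_support[OF c, of "-R" R]) auto
  from step_integral[OF this, of 0 "\<lambda>_. 1" 1 1]
  have "(LBINT x. g' x) = (LBINT x:{..<0}. g' x) + (LBINT x:{0<..}. g' x)" by simp
  moreover have "(LBINT x:{..<0}. g' x) = g 0" by (rule half_line_FTC(1)[OF D c]) (rule supp)
  moreover have "(LBINT x:{0<..}. g' x) = - g 0" by (rule half_line_FTC(2)[OF D c]) (rule supp)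
  ultimately show ?thesis by simp
qed

text \<open>Fubini after the shear \<open>x = X t + y\<close>, which straightens the curve \<open>x = X t\<close>.\<close>

lemma shear_Fubini:
  fixes F :: "real \<times> real \<Rightarrow> real" and X :: "real \<Rightarrow> real"
  assumes F: "continuous_on UNIV F" and X: "continuous_on UNIV X" and A: "A \<in> sets borel"
    and supp: "\<And>x t. x \<notin> {a..b} \<or> t \<notin> {c..d} \<Longrightarrow> F (x, t) = 0"
  shows "integrable lborel (\<lambda>t. LBINT x. indicator A (x - X t) * F (x, t))"
    and "(LBINT t. LBINT x. indicator A (x - X t) * F (x, t))
      = (LBINT y. indicator A y * (LBINT t. F (X t + y, t)))"
proof -
  obtain B where B: "\<bar>F p\<bar> \<le> B" for p using continuous_box_support_bounded[OF F supp] by blast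
  have "bounded (X ` {c..d})"
    using X by (intro compact_imp_bounded compact_continuous_image) (auto intro: continuous_on_subset)
  then obtain M where M: "\<And>t. t \<in> {c..d} \<Longrightarrow> \<bar>X t\<bar> \<le> M"
    unfolding bounded_pos by (metis imageI real_norm_def)
  \<comment> \<open>\<open>y\<close> is the offset from the curve. Since \<open>X\<close> varies
    within \<open>M\<close> on the time interval, the support lies in the box
    \<open>L\<close>.\<close>
  define H where "H = (\<lambda>(t, y). indicator A y * F (X t + y, t))"
  define L where "L = {(c, a - M)..(d, b + M)}"
  have [measurable]: "F \<in> borel_measurable borel" "X \<in> borel_measurable borel"
    using F X by (auto intro: borel_measurable_continuous_onI)
  have [measurable]: "F \<in> borel_measurable (borel \<Otimes>\<^sub>M borel)" unfolding borel_prod by measurable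
  have H: "integrable (lborel \<Otimes>\<^sub>M lborel) H"
  proof (rule Bochner_Integration.integrable_bound)
    have "integrable lborel (\<lambda>p. indicator L p * B)"
      by (intro integrable_mult_left integrable_real_indicator)
        (auto simp: L_def cbox_interval[symmetric] emeasure_lborel_cbox_eq)
    then show "integrable (lborel \<Otimes>\<^sub>M lborel) (\<lambda>p. indicator L p * B)" by (simp add: lborel_prod)
    show "H \<in> borel_measurable (lborel \<Otimes>\<^sub>M lborel)" unfolding H_def using A by measurable
    show "AE p in lborel \<Otimes>\<^sub>M lborel. norm (H p) \<le> norm (indicator L p * B)"
    proof (intro AE_I2, clarify)
      fix t y
      show "norm (H (t, y)) \<le> norm (indicator L (t, y) * B)"
      proof (cases "(t, y) \<in> L")
        case True
        then show ?thesis using B[of "(X t + y, t)"] by (auto simp: H_def indicator_def abs_mult)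
      next
        case False
        then have "X t + y \<notin> {a..b} \<or> t \<notin> {c..d}"
          using M[of t] by (auto simp: L_def less_eq_prod_def)
        then show ?thesis using supp by (simp add: H_def)
      qed
    qed
  qed
  have shift: "(LBINT x. indicator A (x - X t) * F (x, t)) = (LBINT y. H (t, y))" for t
    using lborel_integral_real_affine[of 1 "\<lambda>x. indicator A (x - X t) * F (x, t)" "X t"]
    by (simp add: H_def)
  show "integrable lborel (\<lambda>t. LBINT x. indicator A (x - X t) * F (x, t))"
    unfolding shift using lborel_pair.integrable_fst'[OF H] .
  have "(LBINT t. LBINT y. H (t, y)) = (LBINT y. LBINT t. H (t, y))"
    using lborel_pair.Fubini_integral[of "\<lambda>t y. H (t, y)"] H by simp
  then show "(LBINT t. LBINT x. indicator A (x - X t) * F (x, t))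
      = (LBINT y. indicator A y * (LBINT t. F (X t + y, t)))"
    unfolding shift by (simp add: H_def)
qed

context plane_test
begin

lemma continuous_section:
  "continuous_on A (\<lambda>x. \<phi> (x, t))" "continuous_on A (\<lambda>x. \<phi>x (x, t))" "continuous_on A (\<lambda>x. \<phi>t (x, t))"
  by ((rule continuous_on_compose2[OF cont(1)[of UNIV]] | rule continuous_on_compose2[OF cont(2)[of UNIV]]
      | rule continuous_on_compose2[OF cont(3)[of UNIV]]), auto intro!: continuous_intros)+

lemma continuous_curve:
  assumes "continuous_on A X"
  shows "continuous_on A (\<lambda>t. \<phi> (X t, t))" "continuous_on A (\<lambda>t. \<phi>x (X t, t))" "continuous_on A (\<lambda>t. \<phi>t (X t, t))"
  by ((rule continuous_on_compose2[OF cont(1)[of UNIV]] | rule continuous_on_compose2[OF cont(2)[of UNIV]]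
      | rule continuous_on_compose2[OF cont(3)[of UNIV]]), auto intro!: continuous_intros assms)+

lemma DERIV_x: "((\<lambda>x. \<phi> (x, t)) has_real_derivative \<phi>x (x, t)) (at x)"
  using DERIV_curve[of "\<lambda>x. x" 1 x "\<lambda>_. t" 0] by simp

lemma integrable_section:
  "integrable lborel (\<lambda>x. \<phi> (x, t))" "integrable lborel (\<lambda>x. \<phi>x (x, t))" "integrable lborel (\<lambda>x. \<phi>t (x, t))"
  using vanish by (auto intro!: integrable_continuous_support[of _ "-R" R] continuous_section)

lemma half_line_x:
  "(LBINT x:{..<Y}. \<phi>x (x, t)) = \<phi> (Y, t)" "(LBINT x:{Y<..}. \<phi>x (x, t)) = - \<phi> (Y, t)"
  using half_line_FTC[OF DERIV_x continuous_section(2), of R t Y] vanish by auto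

text \<open>The derivative of \<phi> along each translate \<open>X t + y\<close> of the curve
  integrates to 0 in time. Summing over the translates on one side, and using that
  \<open>\<phi>x\<close> integrates over a half line to plus or minus the value of \<phi> on the
  curve, gives the balance for that side.\<close>

lemma sweep:
  assumes X: "\<And>t. (X has_real_derivative X' t) (at t)" and X': "continuous_on UNIV X'"
  shows "integrable lborel (\<lambda>t. LBINT x:{..<X t}. \<phi>t (x, t))"
    and "integrable lborel (\<lambda>t. LBINT x:{X t<..}. \<phi>t (x, t))"
    and "(LBINT t. (LBINT x:{..<X t}. \<phi>t (x, t)) + X' t * \<phi> (X t, t)) = 0"
    and "(LBINT t. (LBINT x:{X t<..}. \<phi>t (x, t)) - X' t * \<phi> (X t, t)) = 0"
proof -
  have cX: "continuous_on UNIV X"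
    by (meson X DERIV_continuous_on has_field_derivative_at_within)
  define F where "F = (\<lambda>p. \<phi>t p + X' (snd p) * \<phi>x p)"
  have cF: "continuous_on UNIV F"
    unfolding F_def by (intro continuous_intros cont continuous_on_compose2[OF X']) auto
  have supp: "F (x, t) = 0 \<and> \<phi>t (x, t) = 0" if "x \<notin> {-R..R} \<or> t \<notin> {t0..R}" for x t
    using vanish[OF that] by (simp add: F_def)
  have ind: "indicator {..<0} (x - X t) = (indicator {..<X t} x :: real)"
    "indicator {0<..} (x - X t) = (indicator {X t<..} x :: real)" for x t
    by (auto simp: indicator_def)
  note S1 = shear_Fubini(1)[OF cont(3) cX _ conjunct2[OF supp]]
  show "integrable lborel (\<lambda>t. LBINT x:{..<X t}. \<phi>t (x, t))"
    "integrable lborel (\<lambda>t. LBINT x:{X t<..}. \<phi>t (x, t))"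
    using S1[of "{..<0}"] S1[of "{0<..}"] by (auto simp: ind set_lebesgue_integral_def)
  have zero: "(LBINT t. F (X t + y, t)) = 0" for y
  proof (rule integral_derivative_eq_0[where R = R])
    show "((\<lambda>t. \<phi> (X t + y, t)) has_real_derivative F (X t + y, t)) (at t)" for t
    proof -
      have "((\<lambda>t. X t + y) has_real_derivative X' t) (at t)" by (auto intro!: derivative_eq_intros X)
      from DERIV_curve[OF this DERIV_ident] show ?thesis by (simp add: F_def algebra_simps)
    qed
    show "continuous_on UNIV (\<lambda>t. F (X t + y, t))"
      by (intro continuous_on_compose2[OF cF] continuous_intros cX) auto
    show "\<phi> (X t + y, t) = 0 \<and> F (X t + y, t) = 0" if "t \<notin> {-R..R}" for t
      using that vanish[of "X t + y" t] t0_pos by (auto simp: F_def)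
  qed
  have S2: "(LBINT t. LBINT x. indicator A (x - X t) * F (x, t)) = 0" if "A \<in> sets borel" for A :: "real set"
    using shear_Fubini(2)[OF cF cX that conjunct1[OF supp]] by (simp add: zero)
  have i: "integrable lborel (\<lambda>x. indicator A x * f (x, t))" if "A \<in> sets borel" "f \<in> {\<phi>x, \<phi>t}" for A t f
    using integrable_mult_indicator[of A lborel "\<lambda>x. f (x, t)"] integrable_section[of t] that by auto
  have "(LBINT x:{..<X t}. \<phi>t (x, t)) + X' t * \<phi> (X t, t) = (LBINT x. indicator {..<0} (x - X t) * F (x, t))" for t
  proof -
    have "(LBINT x. indicator {..<0} (x - X t) * F (x, t))
      = (LBINT x. indicator {..<X t} x * \<phi>t (x, t) + X' t * (indicator {..<X t} x * \<phi>x (x, t)))"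
      by (simp add: ind F_def algebra_simps)
    also have "\<dots> = (LBINT x:{..<X t}. \<phi>t (x, t)) + X' t * (LBINT x:{..<X t}. \<phi>x (x, t))"
      using i by (simp add: set_lebesgue_integral_def)
    finally show ?thesis by (simp add: half_line_x)
  qed
  then show "(LBINT t. (LBINT x:{..<X t}. \<phi>t (x, t)) + X' t * \<phi> (X t, t)) = 0"
    using S2[of "{..<0}"] by simp
  have "(LBINT x:{X t<..}. \<phi>t (x, t)) - X' t * \<phi> (X t, t) = (LBINT x. indicator {0<..} (x - X t) * F (x, t))" for t
  proof -
    have "(LBINT x. indicator {0<..} (x - X t) * F (x, t))
      = (LBINT x. indicator {X t<..} x * \<phi>t (x, t) + X' t * (indicator {X t<..} x * \<phi>x (x, t)))"
      by (simp add: ind F_def algebra_simps)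
    also have "\<dots> = (LBINT x:{X t<..}. \<phi>t (x, t)) + X' t * (LBINT x:{X t<..}. \<phi>x (x, t))"
      using i by (simp add: set_lebesgue_integral_def)
    finally show ?thesis by (simp add: half_line_x)
  qed
  then show "(LBINT t. (LBINT x:{X t<..}. \<phi>t (x, t)) - X' t * \<phi> (X t, t)) = 0"
    using S2[of "{0<..}"] by simp
qed

end

lemma step_integral_tendsto:
  fixes \<psi> :: "real \<Rightarrow> real" and s :: "real \<Rightarrow> real \<Rightarrow> real"
  assumes \<psi>: "continuous_on UNIV \<psi>" "\<And>x. x \<notin> {-R..R} \<Longrightarrow> \<psi> x = 0"
    and X: "(X \<longlongrightarrow> 0) (at_right 0)"
    and s: "\<And>x t. s x t = (if x < X t then a else if x = X t then c else b)"
  shows "((\<lambda>t. LBINT x. s x t * \<psi> x) \<longlongrightarrow> (LBINT x. riemann_data a b x * \<psi> x)) (at_right 0)"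
proof -
  have i: "integrable lborel \<psi>" by (rule integrable_continuous_support[OF \<psi>])
  have st: "(LBINT x. s x t * \<psi> x) = a * (LBINT x:{..<X t}. \<psi> x) + b * (LBINT x:{X t<..}. \<psi> x)" for t
    by (rule step_integral[OF i]) (auto simp: s)
  have rd: "(LBINT x. riemann_data a b x * \<psi> x) = a * (LBINT x:{..<0}. \<psi> x) + b * (LBINT x:{0<..}. \<psi> x)"
    by (rule step_integral[OF i]) (auto simp: riemann_data_def)
  have [measurable]: "\<psi> \<in> borel_measurable borel" using \<psi>(1) by (rule borel_measurable_continuous_onI)
  show ?thesis
    unfolding st rd
  proof (intro tendsto_intros tendsto_at_right_sequentially[of 0 1])
    fix S :: "nat \<Rightarrow> real" assume S: "\<And>n. 0 < S n" "S \<longlonglongrightarrow> 0"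
    have "S n \<noteq> 0" for n using S(1)[of n] by simp
    with S have "filterlim S (at_right 0) sequentially"
      by (auto simp: filterlim_at)
    then have XS: "(\<lambda>n. X (S n)) \<longlonglongrightarrow> 0" by (rule filterlim_compose[OF X])
    have ev: "eventually (\<lambda>n. (x < X (S n)) = (x < 0) \<and> (X (S n) < x) = (0 < x)) sequentially" if "x \<noteq> 0" for x
    proof (cases "x < 0")
      case True
      from order_tendstoD(1)[OF XS this] show ?thesis by eventually_elim (use True in auto)
    next
      case False
      then have "x > 0" using that by simp
      from order_tendstoD(2)[OF XS this] show ?thesis by eventually_elim (use \<open>x > 0\<close> in auto)
    qed
    show "(\<lambda>n. LBINT x:{..<X (S n)}. \<psi> x) \<longlonglongrightarrow> (LBINT x:{..<0}. \<psi> x)"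
      unfolding set_lebesgue_integral_def
    proof (rule integral_dominated_convergence[where w = "\<lambda>x. \<bar>\<psi> x\<bar>"])
      show "AE x in lborel. (\<lambda>n. indicator {..<X (S n)} x *\<^sub>R \<psi> x) \<longlonglongrightarrow> indicator {..<0} x *\<^sub>R \<psi> x"
        using AE_lborel_singleton[of 0]
      proof eventually_elim
        case (elim x)
        show ?case by (rule tendsto_eventually, use ev[OF elim] in eventually_elim) (auto simp: indicator_def)
      qed
    qed (use i in \<open>auto simp: indicator_def\<close>)
    show "(\<lambda>n. LBINT x:{X (S n)<..}. \<psi> x) \<longlonglongrightarrow> (LBINT x:{0<..}. \<psi> x)"
      unfolding set_lebesgue_integral_def
    proof (rule integral_dominated_convergence[where w = "\<lambda>x. \<bar>\<psi> x\<bar>"])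
      show "AE x in lborel. (\<lambda>n. indicator {X (S n)<..} x *\<^sub>R \<psi> x) \<longlonglongrightarrow> indicator {0<..} x *\<^sub>R \<psi> x"
        using AE_lborel_singleton[of 0]
      proof eventually_elim
        case (elim x)
        show ?case by (rule tendsto_eventually, use ev[OF elim] in eventually_elim) (auto simp: indicator_def)
      qed
    qed (use i in \<open>auto simp: indicator_def\<close>)
  qed simp_all
qed

context plane_test
begin

lemma integrable_curve:
  assumes "continuous_on UNIV X" "continuous_on UNIV c"
  shows "integrable lborel (\<lambda>t. c t * \<phi> (X t, t))" "integrable lborel (\<lambda>t. c t * \<phi>x (X t, t))"
    "integrable lborel (\<lambda>t. c t * \<phi>t (X t, t))"
  using vanish
  by (auto intro!: integrable_continuous_support[of _ t0 R] continuous_intros continuous_curve assms)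

end

subsection \<open>The delta shock solves the limit system\<close>

locale delta_shock_params =
  fixes \<alpha> :: real and k :: nat and vm um vp up \<sigma> w0 ud :: real
  assumes \<alpha>_pos: "\<alpha> > 0" and k_pos: "k > 0"
begin

abbreviation W :: delta_wave where "W \<equiv> delta_shock \<alpha> k vm um vp up \<sigma> w0 ud"

definition decay :: "real \<Rightarrow> real" where "decay t = exp (- \<alpha> * real k * t)"
text \<open>The intrinsic time of the problem: the primitive of \<open>decay\<close> that vanishes
  at 0. Shock curve and weight are linear in it, and for \<open>t > 0\<close> the similarity
  variable is \<open>x / scale t\<close>.\<close>

definition scale :: "real \<Rightarrow> real" where "scale t = (1 - decay t) / (\<alpha> * real k)"

lemma curve_eq: "shock_curve \<alpha> k \<sigma> t = \<sigma> * scale t"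
  by (simp add: shock_curve_def scale_def decay_def)

lemma W_simps:
  "curve W = (\<lambda>t. \<sigma> * scale t)" "weight W = (\<lambda>t. w0 * scale t)"
  "regular W = (\<lambda>x t. if x < \<sigma> * scale t then vm else vp)"
  "velocity W = (\<lambda>x t. if x < \<sigma> * scale t then um else if x = \<sigma> * scale t then ud else up)"
  by (auto simp: delta_shock_def curve_eq fun_eq_iff scale_def decay_def)

lemma DERIV_scale: "(scale has_real_derivative decay t) (at t)"
  using \<alpha>_pos k_pos unfolding scale_def[abs_def] decay_def
  by (auto intro!: derivative_eq_intros)

lemma continuous_scale: "continuous_on A scale" and continuous_decay: "continuous_on A decay"
  using \<alpha>_pos k_pos unfolding scale_def[abs_def] decay_def[abs_def] by (auto intro!: continuous_intros)

lemma scale_0: "scale 0 = 0"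
  by (simp add: scale_def decay_def)

lemma scale_mono: "s \<le> t \<Longrightarrow> scale s \<le> scale t"
  unfolding scale_def decay_def using \<alpha>_pos k_pos by (intro divide_right_mono) auto

lemma scale_pos: "t > 0 \<Longrightarrow> scale t > 0"
  unfolding scale_def decay_def using \<alpha>_pos k_pos by simp

lemma similarity_variable_eq: "t > 0 \<Longrightarrow> similarity_variable \<alpha> k x t = x / scale t"
  by (simp add: similarity_variable_def scale_def decay_def)

lemma pairing_eq:
  assumes int: "\<And>t. integrable lborel (\<lambda>x. h (x, t))"
    and h0: "\<And>x t. t \<le> 0 \<Longrightarrow> h (x, t) = 0"
  shows "pairing W G h
    = (LBINT t. vm * G um * (LBINT x:{..<\<sigma> * scale t}. h (x, t)) + vp * G up * (LBINT x:{\<sigma> * scale t<..}. h (x, t)))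
      + (LBINT t. w0 * G ud * (scale t * h (\<sigma> * scale t, t)))"
proof -
  have "(LBINT x. regular W x t * G (velocity W x t) * h (x, t))
    = vm * G um * (LBINT x:{..<\<sigma> * scale t}. h (x, t)) + vp * G up * (LBINT x:{\<sigma> * scale t<..}. h (x, t))" for t
    by (rule step_integral[OF int]) (auto simp: W_simps)
  moreover have "(LBINT t:{0<..}. vm * G um * (LBINT x:{..<\<sigma> * scale t}. h (x, t)) + vp * G up * (LBINT x:{\<sigma> * scale t<..}. h (x, t)))
    = (LBINT t. vm * G um * (LBINT x:{..<\<sigma> * scale t}. h (x, t)) + vp * G up * (LBINT x:{\<sigma> * scale t<..}. h (x, t)))"
    by (rule set_integral_eq_integral) (simp add: h0 set_lebesgue_integral_def)
  moreover have "(LBINT t:{0<..}. weight W t * G (velocity W (curve W t) t) * h (curve W t, t))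
    = (LBINT t. weight W t * G (velocity W (curve W t) t) * h (curve W t, t))"
    by (rule set_integral_eq_integral) (simp add: h0)
  moreover have "weight W t * G (velocity W (curve W t) t) * h (curve W t, t)
    = w0 * G ud * (scale t * h (\<sigma> * scale t, t))" for t
    by (simp add: W_simps)
  ultimately show ?thesis unfolding pairing_def by (simp only:)
qed

text \<open>Both equations are instances, with \<open>G1\<close>, \<open>G2\<close> equal to 1 and
  the power \<open>k\<close>, or to the identity and the power \<open>k + 1\<close>. The second
  hypothesis is the jump relation with the Dirac mass as deficit; the third says that the mass is
  carried with speed \<sigma>.\<close>

lemma balance:
  assumes "plane_test \<phi> \<phi>x \<phi>t t0 R"
    and w0: "w0 * G1 ud = - \<sigma> * (vm * G1 um - vp * G1 up) + (vm * G2 um - vp * G2 up)"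
    and ud: "G2 ud = \<sigma> * G1 ud"
  shows "pairing W G1 \<phi>t + pairing W G2 (\<lambda>(x, t). exp (- \<alpha> * real k * t) * \<phi>x (x, t)) = 0"
proof -
  interpret plane_test \<phi> \<phi>x \<phi>t t0 R by fact
  define X where "X t = \<sigma> * scale t" for t
  define Il where "Il t = (LBINT x:{..<X t}. \<phi>t (x, t))" for t
  define Ir where "Ir t = (LBINT x:{X t<..}. \<phi>t (x, t))" for t
  define q where "q t = decay t * \<phi> (X t, t)" for t
  define qt where "qt t = scale t * \<phi>t (X t, t)" for t
  define qx where "qx t = scale t * decay t * \<phi>x (X t, t)" for t
  have DX: "(X has_real_derivative \<sigma> * decay t) (at t)" for t
    unfolding X_def[abs_def] by (auto intro!: derivative_eq_intros DERIV_scale)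
  have cX: "continuous_on UNIV X" unfolding X_def[abs_def] by (intro continuous_intros continuous_scale)
  have van: "\<phi> (x, t) = 0 \<and> \<phi>x (x, t) = 0 \<and> \<phi>t (x, t) = 0" if "t \<notin> {t0..R}" for x t
    using vanish that by blast
  have van0: "\<phi> (x, t) = 0 \<and> \<phi>x (x, t) = 0 \<and> \<phi>t (x, t) = 0" if "t \<le> 0" for x t
    using van[of t] that t0_pos by auto
  note sw = sweep[OF DX continuous_on_mult_left[OF continuous_decay]]
  have i [simp]: "integrable lborel Il" "integrable lborel Ir" "integrable lborel q" "integrable lborel qt" "integrable lborel qx"
    using sw(1,2) integrable_curve[OF cX, of decay] integrable_curve[OF cX, of scale]
      integrable_curve[OF cX, of "\<lambda>t. scale t * decay t"]
    by (auto simp: Il_def[abs_def] Ir_def[abs_def] q_def[abs_def] qt_def[abs_def] qx_def[abs_def]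
        continuous_on_mult continuous_scale continuous_decay)
  have P1: "pairing W G1 \<phi>t = (LBINT t. vm * G1 um * Il t + vp * G1 up * Ir t) + (LBINT t. w0 * G1 ud * qt t)"
    unfolding Il_def Ir_def qt_def X_def
    by (rule pairing_eq) (use integrable_section van0 in auto)
  have hl: "(LBINT x:{..<X t}. decay t * \<phi>x (x, t)) = q t" "(LBINT x:{X t<..}. decay t * \<phi>x (x, t)) = - q t" for t
    by (simp_all add: q_def half_line_x)
  have "pairing W G2 (\<lambda>(x, t). decay t * \<phi>x (x, t))
    = (LBINT t. vm * G2 um * (LBINT x:{..<X t}. decay t * \<phi>x (x, t)) + vp * G2 up * (LBINT x:{X t<..}. decay t * \<phi>x (x, t)))
      + (LBINT t. w0 * G2 ud * qx t)"
    using pairing_eq[of "\<lambda>(x, t). decay t * \<phi>x (x, t)" G2] integrable_section van0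
    by (simp add: X_def qx_def mult_ac)
  then have P2: "pairing W G2 (\<lambda>(x, t). decay t * \<phi>x (x, t))
    = (LBINT t. vm * G2 um * q t + vp * G2 up * (- q t)) + (LBINT t. w0 * G2 ud * qx t)"
    unfolding hl .
  have Z1: "integral\<^sup>L lborel Il + \<sigma> * integral\<^sup>L lborel q = 0"
    using sw(3) by (simp add: Il_def[symmetric] mult.assoc q_def[symmetric])
  have Z2: "integral\<^sup>L lborel Ir - \<sigma> * integral\<^sup>L lborel q = 0"
    using sw(4) by (simp add: Ir_def[symmetric] mult.assoc q_def[symmetric])
  \<comment> \<open>The integrand is the derivative of \<open>scale t * \<phi> (X t, t)\<close>,
    which has compact support. This trades \<open>qt\<close> for \<open>q\<close> and
    \<open>qx\<close>.\<close>
  have "(LBINT t. q t + (qt t + \<sigma> * qx t)) = 0"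
  proof (rule integral_derivative_eq_0[where R = R])
    show "((\<lambda>t. scale t * \<phi> (X t, t)) has_real_derivative q t + (qt t + \<sigma> * qx t)) (at t)" for t
      using DERIV_mult[OF DERIV_scale DERIV_curve[OF DX DERIV_ident]]
      by (simp add: q_def qt_def qx_def algebra_simps)
    show "continuous_on UNIV (\<lambda>t. q t + (qt t + \<sigma> * qx t))"
      unfolding q_def qt_def qx_def
      by (intro continuous_intros continuous_curve cX continuous_decay continuous_scale)
    show "scale t * \<phi> (X t, t) = 0 \<and> q t + (qt t + \<sigma> * qx t) = 0" if "t \<notin> {-R..R}" for t
      using van[of t "X t"] that t0_pos by (auto simp: q_def qt_def qx_def)
  qed
  then have Z3: "integral\<^sup>L lborel q + (integral\<^sup>L lborel qt + \<sigma> * integral\<^sup>L lborel qx) = 0" by simp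
  define q' where "q' = integral\<^sup>L lborel q"
  define qx' where "qx' = integral\<^sup>L lborel qx"
  have vals: "integral\<^sup>L lborel Il = - \<sigma> * q'" "integral\<^sup>L lborel Ir = \<sigma> * q'" "integral\<^sup>L lborel qt = - q' - \<sigma> * qx'"
    using Z1 Z2 Z3 by (auto simp: q'_def qx'_def)
  have "pairing W G1 \<phi>t + pairing W G2 (\<lambda>(x, t). decay t * \<phi>x (x, t))
    = vm * G1 um * (- \<sigma> * q') + vp * G1 up * (\<sigma> * q') + w0 * G1 ud * (- q' - \<sigma> * qx')
      + (vm * G2 um * q' + vp * G2 up * (- q')) + w0 * G2 ud * qx'"
    unfolding P1 P2 by (simp add: vals q'_def[symmetric] qx'_def[symmetric])
  \<comment> \<open>Grouped by the two remaining integrals, the coefficients are exactly the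
    differences of the two sides of the hypotheses \<open>w0\<close> and \<open>ud\<close>.\<close>
  also have "\<dots> = q' * (- \<sigma> * (vm * G1 um - vp * G1 up) + (vm * G2 um - vp * G2 up) - w0 * G1 ud)
      + w0 * qx' * (G2 ud - \<sigma> * G1 ud)"
    by (simp add: algebra_simps)
  also have "\<dots> = 0" unfolding w0 ud by simp
  finally show ?thesis unfolding decay_def .
qed

text \<open>Curve and weight both tend to 0 with \<open>scale\<close>, so the jump moves to the
  origin and the Dirac part disappears.\<close>

lemma initial_data: "attains_initial_data W (riemann_data vm vp) (riemann_data um up)"
  unfolding attains_initial_data_def
proof (intro allI impI conjI)
  fix \<psi> :: "real \<Rightarrow> real" assume "test_function UNIV \<psi>"
  then obtain R where \<psi>: "R > 0" "continuous_on UNIV \<psi>" "\<And>x. x \<notin> {-R..R} \<Longrightarrow> \<psi> x = 0"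
    by (rule test_function_real) blast
  have "(scale \<longlongrightarrow> scale 0) (at_right 0)"
    using continuous_scale[of UNIV] by (auto simp: continuous_on_def intro: tendsto_within_subset)
  then have sc: "(scale \<longlongrightarrow> 0) (at_right 0)" by (simp add: scale_0)
  have X: "((\<lambda>t. \<sigma> * scale t) \<longlongrightarrow> 0) (at_right 0)" using tendsto_mult_left[OF sc, of \<sigma>] by simp
  show "((\<lambda>t. LBINT x. velocity W x t * \<psi> x) \<longlongrightarrow> (LBINT x. riemann_data um up x * \<psi> x)) (at_right 0)"
    by (rule step_integral_tendsto[OF \<psi>(2,3) X]) (auto simp: W_simps)
  have A: "((\<lambda>t. LBINT x. regular W x t * \<psi> x) \<longlongrightarrow> (LBINT x. riemann_data vm vp x * \<psi> x)) (at_right 0)"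
    by (rule step_integral_tendsto[OF \<psi>(2,3) X, where c = vp]) (auto simp: W_simps)
  have "isCont \<psi> 0" using \<psi>(2) by (simp add: continuous_on_eq_continuous_at)
  then have "((\<lambda>t. \<psi> (\<sigma> * scale t)) \<longlongrightarrow> \<psi> 0) (at_right 0)" by (rule isCont_tendsto_compose[OF _ X])
  from tendsto_mult[OF tendsto_mult_left[OF sc, of w0] this]
  have "((\<lambda>t. weight W t * \<psi> (curve W t)) \<longlongrightarrow> 0) (at_right 0)" by (simp add: W_simps)
  from tendsto_add[OF A this]
  show "((\<lambda>t. (LBINT x. regular W x t * \<psi> x) + weight W t * \<psi> (curve W t))
      \<longlongrightarrow> (LBINT x. riemann_data vm vp x * \<psi> x)) (at_right 0)" by simp
qed

lemma solves:
  assumes "delta_shock_constants k vm um vp up \<sigma> w0 ud"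
  shows "solves_limit_system \<alpha> k W"
  unfolding solves_limit_system_def
proof (intro allI impI conjI)
  fix \<phi> :: "real \<times> real \<Rightarrow> real" assume "test_function half_plane \<phi>"
  then obtain t0 R where "plane_test \<phi> (deriv_x \<phi>) (deriv_t \<phi>) t0 R" by (rule test_function_half_plane)
  note b = balance[OF this]
  show "pairing W (\<lambda>_. 1) (deriv_t \<phi>)
      + pairing W (\<lambda>u. u ^ k) (\<lambda>(x, t). exp (- \<alpha> * real k * t) * deriv_x \<phi> (x, t)) = 0"
    using assms by (intro b) (auto simp: delta_shock_constants_def)
  show "pairing W (\<lambda>u. u) (deriv_t \<phi>)
      + pairing W (\<lambda>u. u ^ (k + 1)) (\<lambda>(x, t). exp (- \<alpha> * real k * t) * deriv_x \<phi> (x, t)) = 0"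
    using assms by (intro b) (auto simp: delta_shock_constants_def)
qed

end

subsection \<open>Convergence\<close>

context viscous_profile
begin

text \<open>After rescaling, \<open>- v\<close> is the derivative of the flux; the possibly singular
  density is exchanged for a continuous function. In use \<open>r\<close> is
  \<open>scale t\<close>.\<close>

lemma integral_by_parts:
  assumes r: "r > 0" and g: "\<And>x. (g has_real_derivative g' x) (at x)" and c: "continuous_on UNIV g'"
    and supp: "\<And>x. x \<notin> {-R..R} \<Longrightarrow> g x = 0 \<and> g' x = 0"
  shows "(LBINT x. v (x / r) * g x) = r * (LBINT x. flux (x / r) * g' x)"
proof -
  define L where "L = \<bar>R\<bar> + 1"
  have out: "g x = 0 \<and> g' x = 0" if "x \<notin> {-L<..<L}" for x
    using that by (intro supp) (auto simp: L_def)
  have L: "L > 0" by (simp add: L_def)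
  have cg: "continuous_on UNIV g"
    by (meson g DERIV_continuous_on has_field_derivative_at_within)
  have cf: "continuous_on A (\<lambda>x. flux (x / r))" for A
    using r by (intro continuous_on_compose2[OF continuous_flux[of UNIV]] continuous_intros) auto
  have [measurable]: "g \<in> borel_measurable borel" using cg by (rule borel_measurable_continuous_onI)
  obtain B where B: "\<bar>g x\<bar> \<le> B" for x
  proof -
    have "bounded (g ` {-L..L})"
      using cg by (intro compact_imp_bounded compact_continuous_image) (auto intro: continuous_on_subset)
    then obtain B where B: "B > 0" "\<And>x. x \<in> {-L..L} \<Longrightarrow> \<bar>g x\<bar> \<le> B"
      unfolding bounded_pos by (metis imageI real_norm_def)
    have "\<bar>g x\<bar> \<le> B" for x using B out[of x] by (cases "x \<in> {-L..L}") auto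
    then show thesis by (rule that)
  qed
  \<comment> \<open>Local integrability of \<open>v\<close>, rescaled, makes the left side a genuine
    Lebesgue integral, so that it agrees with the gauge integral computed below.\<close>
  have iv: "integrable lborel (\<lambda>x. v (x / r) * g x)"
  proof (rule Bochner_Integration.integrable_bound)
    have "set_integrable lborel {-L/r..L/r} v"
      using profile by (simp add: similarity_profile_def locally_L1_def)
    then have "integrable lborel (\<lambda>x. indicator {-L/r..L/r} (0 + (1 / r) * x) *\<^sub>R v (0 + (1 / r) * x))"
      unfolding set_integrable_def using r by (intro lborel_integrable_real_affine) auto
    then show "integrable lborel (\<lambda>x. B * (indicator {-L/r..L/r} (x / r) * v (x / r)))"
      by (intro integrable_mult_right) simp
    show "AE x in lborel. norm (v (x / r) * g x) \<le> norm (B * (indicator {-L/r..L/r} (x / r) * v (x / r)))"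
    proof (intro AE_I2)
      fix x
      show "norm (v (x / r) * g x) \<le> norm (B * (indicator {-L/r..L/r} (x / r) * v (x / r)))"
      proof (cases "x \<in> {-L<..<L}")
        case True
        then have "x / r \<in> {-L/r..L/r}" using r divide_right_mono[of "- L" x r] divide_right_mono[of x L r] by auto
        moreover have "\<bar>v (x / r)\<bar> * \<bar>g x\<bar> \<le> \<bar>v (x / r)\<bar> * \<bar>B\<bar>"
          using B[of x] by (intro mult_left_mono) auto
        ultimately show ?thesis by (simp add: abs_mult mult.commute)
      qed (use out in auto)
    qed
  qed measurable
  have if': "integrable lborel (\<lambda>x. r * (flux (x / r) * g' x))"
    using out by (intro integrable_continuous_support[of _ "-L" L] continuous_intros cf c) auto
  \<comment> \<open>The image \<open>r * z\<close> of the singular point is the exceptional point of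
    the fundamental theorem; continuity of the flux suffices there.\<close>
  have "((\<lambda>x. r * (flux (x / r) * g' x) - v (x / r) * g x) has_integral
      (r * (flux (L / r) * g L) - r * (flux (- L / r) * g (- L)))) {-L..L}"
  proof (rule fundamental_theorem_of_calculus_interior_strong[of "{r * z}"])
    show "continuous_on {-L..L} (\<lambda>x. r * (flux (x / r) * g x))"
      by (intro continuous_intros cf continuous_on_subset[OF cg]) auto
    fix x assume "x \<in> {-L<..<L} - {r * z}"
    then have xz: "x / r \<noteq> z" using r by (auto simp: field_simps)
    have "((\<lambda>x. x / r) has_real_derivative 1 / r) (at x)" using r by (auto intro!: derivative_eq_intros)
    from DERIV_chain2[OF DERIV_flux[OF xz] this]
    have "((\<lambda>x. r * (flux (x / r) * g x)) has_real_derivative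
        r * (- v (x / r) * (1 / r) * g x + g' x * flux (x / r))) (at x)"
      by (intro DERIV_cmult DERIV_mult g)
    then show "((\<lambda>x. r * (flux (x / r) * g x)) has_vector_derivative
        r * (flux (x / r) * g' x) - v (x / r) * g x) (at x)"
      using r by (simp add: has_real_derivative_iff_has_vector_derivative[symmetric] algebra_simps)
  qed (use L in auto)
  then have "((\<lambda>x. r * (flux (x / r) * g' x) - v (x / r) * g x) has_integral 0) {-L..L}"
    using out[of L] out[of "- L"] by simp
  then have "((\<lambda>x. r * (flux (x / r) * g' x) - v (x / r) * g x) has_integral 0) UNIV"
    by (rule has_integral_on_superset) (use out in auto)
  moreover have "((\<lambda>x. r * (flux (x / r) * g' x) - v (x / r) * g x) has_integral
      (LBINT x. r * (flux (x / r) * g' x) - v (x / r) * g x)) UNIV"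
    by (intro has_integral_integral_lborel Bochner_Integration.integrable_diff if' iv)
  ultimately have "(LBINT x. r * (flux (x / r) * g' x) - v (x / r) * g x) = 0"
    by (rule has_integral_unique[symmetric])
  then show ?thesis using if' iv by simp
qed

end

section \<open>Limits of shock position, flux and density\<close>

locale delta_shock_limit =
  viscous_family k vm um vp up v u + delta_shock_params \<alpha> k vm um vp up \<sigma> w0 ud
  for k vm um vp up v u \<alpha> \<sigma> w0 ud +
  assumes constants: "delta_shock_constants k vm um vp up \<sigma> w0 ud"
begin

lemma u_z_tendsto: "((\<lambda>\<epsilon>. u \<epsilon> (z \<epsilon>)) \<longlongrightarrow> ud) (at_right 0)"
  using constants unfolding delta_shock_constants_iff[OF odd_k]
  by (intro shock_defect_tendsto_imp[OF odd_k vm_pos vp_pos _ _ _ eventually_u_z_range shock_defect_tendsto_0]) auto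

lemma z_tendsto: "(z \<longlongrightarrow> \<sigma>) (at_right 0)"
proof -
  have "((\<lambda>\<epsilon>. u \<epsilon> (z \<epsilon>) ^ k) \<longlongrightarrow> \<sigma>) (at_right 0)"
    using tendsto_power[OF u_z_tendsto, of k] constants by (simp add: delta_shock_constants_def)
  moreover have "eventually (\<lambda>\<epsilon>. u \<epsilon> (z \<epsilon>) ^ k = z \<epsilon>) (at_right 0)"
    by (intro eventually_profile viscous_profile.fixed_point)
  ultimately show ?thesis by (rule Lim_transform_eventually)
qed

text \<open>The limit of the flux off \<sigma>. Its slopes are \<open>- vm\<close> and
  \<open>- vp\<close>, and its drop at \<sigma>,
  \<open>vm * (um ^ k - \<sigma>) - vp * (up ^ k - \<sigma>)\<close>, is exactly
  \<open>w0\<close>.\<close>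

definition flux0 :: "real \<Rightarrow> real" where
  "flux0 x = (if x < \<sigma> then vm * (um ^ k - x) else vp * (up ^ k - x))"

lemma flux_eq: "eventually (\<lambda>\<epsilon>. v \<epsilon> x * (u \<epsilon> x ^ k - x) = flux \<epsilon> x) (at_right 0)"
  by (rule eventually_profile) (simp add: viscous_profile.flux_def)

lemma limits_right:
  assumes "x > \<sigma>"
  shows "((\<lambda>\<epsilon>. u \<epsilon> x) \<longlongrightarrow> up) (at_right 0)" "((\<lambda>\<epsilon>. flux \<epsilon> x) \<longlongrightarrow> flux0 x) (at_right 0)"
proof -
  \<comment> \<open>Half the distance to \<sigma>: once \<open>z \<epsilon>\<close> is below
    \<open>\<sigma> + \<delta>\<close>, the point \<open>x\<close> keeps distance \<delta> from
    it.\<close>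
  define \<delta> where "\<delta> = (x - \<sigma>) / 2"
  have \<delta>: "\<delta> > 0" using assms by (simp add: \<delta>_def)
  have "eventually (\<lambda>\<epsilon>. z \<epsilon> < \<sigma> + \<delta>) (at_right 0)"
    by (rule order_tendstoD[OF z_tendsto]) (use \<delta> in simp)
  then have "eventually (\<lambda>\<epsilon>. z \<epsilon> + \<delta> \<le> x) (at_right 0)"
    by eventually_elim (simp add: \<delta>_def field_simps)
  note R = right_limits[OF \<delta> this]
  show "((\<lambda>\<epsilon>. u \<epsilon> x) \<longlongrightarrow> up) (at_right 0)" by (rule R)
  have "((\<lambda>\<epsilon>. v \<epsilon> x * (u \<epsilon> x ^ k - x)) \<longlongrightarrow> flux0 x) (at_right 0)"
    using assms by (auto simp: flux0_def intro!: tendsto_intros R)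
  from Lim_transform_eventually[OF this flux_eq] show "((\<lambda>\<epsilon>. flux \<epsilon> x) \<longlongrightarrow> flux0 x) (at_right 0)" .
qed

lemma limits_left:
  assumes "x < \<sigma>"
  shows "((\<lambda>\<epsilon>. u \<epsilon> x) \<longlongrightarrow> um) (at_right 0)" "((\<lambda>\<epsilon>. flux \<epsilon> x) \<longlongrightarrow> flux0 x) (at_right 0)"
proof -
  define \<delta> where "\<delta> = (\<sigma> - x) / 2"
  have \<delta>: "\<delta> > 0" using assms by (simp add: \<delta>_def)
  have "eventually (\<lambda>\<epsilon>. \<sigma> - \<delta> < z \<epsilon>) (at_right 0)"
    by (rule order_tendstoD[OF z_tendsto]) (use \<delta> in simp)
  then have "eventually (\<lambda>\<epsilon>. x \<le> z \<epsilon> - \<delta>) (at_right 0)"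
    by eventually_elim (simp add: \<delta>_def field_simps)
  note L = left_limits[OF \<delta> this]
  show "((\<lambda>\<epsilon>. u \<epsilon> x) \<longlongrightarrow> um) (at_right 0)" by (rule L)
  have "((\<lambda>\<epsilon>. v \<epsilon> x * (u \<epsilon> x ^ k - x)) \<longlongrightarrow> flux0 x) (at_right 0)"
    using assms by (auto simp: flux0_def intro!: tendsto_intros L)
  from Lim_transform_eventually[OF this flux_eq] show "((\<lambda>\<epsilon>. flux \<epsilon> x) \<longlongrightarrow> flux0 x) (at_right 0)" .
qed

text \<open>Monotonicity reduces a bound on the whole interval to the two points \<open>M\<close>
  and \<open>- M\<close>, which enclose the interval and \<sigma>; there the flux converges.\<close>

lemma flux_bounded:
  obtains B where "B > 0" "eventually (\<lambda>\<epsilon>. \<forall>x. \<bar>x\<bar> \<le> L \<longrightarrow> \<bar>flux \<epsilon> x\<bar> \<le> B) (at_right 0)"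
proof -
  define M where "M = max L \<bar>\<sigma>\<bar> + 1"
  have M: "L \<le> M" "- M < \<sigma>" "\<sigma> < M" by (auto simp: M_def max_def)
  define B where "B = \<bar>flux0 M\<bar> + \<bar>flux0 (- M)\<bar> + 1"
  have "eventually (\<lambda>\<epsilon>. flux0 M - 1 < flux \<epsilon> M) (at_right 0)"
    by (rule order_tendstoD[OF limits_right(2)[OF M(3)]]) simp
  moreover have "eventually (\<lambda>\<epsilon>. flux \<epsilon> (- M) < flux0 (- M) + 1) (at_right 0)"
    by (rule order_tendstoD[OF limits_left(2)[OF M(2)]]) simp
  ultimately have "eventually (\<lambda>\<epsilon>. \<forall>x. \<bar>x\<bar> \<le> L \<longrightarrow> \<bar>flux \<epsilon> x\<bar> \<le> B) (at_right 0)"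
    using eventually_at_right_less[of 0]
  proof eventually_elim
    case (elim \<epsilon>)
    interpret P: viscous_profile k \<epsilon> vm um vp up "v \<epsilon>" "u \<epsilon>" using elim by (intro viscous_profileI)
    show ?case
    proof (intro allI impI)
      fix x assume "\<bar>x\<bar> \<le> L"
      then have "flux \<epsilon> M \<le> flux \<epsilon> x" "flux \<epsilon> x \<le> flux \<epsilon> (- M)"
        using M by (auto intro!: P.flux_antimono)
      then show "\<bar>flux \<epsilon> x\<bar> \<le> B" using elim unfolding B_def by linarith
    qed
  qed
  moreover have "B > 0" by (simp add: B_def)
  ultimately show thesis by (rule that[rotated])
qed

end

lemma (in plane_test) half_line_affine:
  "(LBINT x:{..<Y}. (A - x) * \<phi>x (x, t)) = (A - Y) * \<phi> (Y, t) + (LBINT x:{..<Y}. \<phi> (x, t))"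
  "(LBINT x:{Y<..}. (A - x) * \<phi>x (x, t)) = - (A - Y) * \<phi> (Y, t) + (LBINT x:{Y<..}. \<phi> (x, t))"
  "integrable lborel (\<lambda>x. (A - x) * \<phi>x (x, t))"
proof -
  have D: "((\<lambda>x. (A - x) * \<phi> (x, t)) has_real_derivative (A - x) * \<phi>x (x, t) - \<phi> (x, t)) (at x)" for x
    by (auto intro!: derivative_eq_intros DERIV_x)
  have c: "continuous_on UNIV (\<lambda>x. (A - x) * \<phi>x (x, t) - \<phi> (x, t))"
    by (intro continuous_intros continuous_section)
  have van: "(A - x) * \<phi> (x, t) = 0 \<and> (A - x) * \<phi>x (x, t) - \<phi> (x, t) = 0" if "x \<notin> {-R..R}" for x
    using vanish[of x t] that by simp
  show i: "integrable lborel (\<lambda>x. (A - x) * \<phi>x (x, t))"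
    using vanish by (intro integrable_continuous_support[of _ "-R" R] continuous_intros continuous_section) auto
  have s: "set_integrable lborel S (\<lambda>x. (A - x) * \<phi>x (x, t))" "set_integrable lborel S (\<lambda>x. \<phi> (x, t))"
    if "S \<in> sets borel" for S :: "real set"
    unfolding set_integrable_def
    using that by (auto intro!: integrable_mult_indicator i integrable_section simp del: real_scaleR_def)
  have "(LBINT x:{..<Y}. (A - x) * \<phi>x (x, t) - \<phi> (x, t)) = (A - Y) * \<phi> (Y, t)"
    "(LBINT x:{Y<..}. (A - x) * \<phi>x (x, t) - \<phi> (x, t)) = - ((A - Y) * \<phi> (Y, t))"
    by (rule half_line_FTC[OF D c], rule van, assumption)+
  then show "(LBINT x:{..<Y}. (A - x) * \<phi>x (x, t)) = (A - Y) * \<phi> (Y, t) + (LBINT x:{..<Y}. \<phi> (x, t))"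
    "(LBINT x:{Y<..}. (A - x) * \<phi>x (x, t)) = - (A - Y) * \<phi> (Y, t) + (LBINT x:{Y<..}. \<phi> (x, t))"
    using set_integral_diff(2)[OF s(1)[of "{..<Y}"] s(2)[of "{..<Y}"]]
      set_integral_diff(2)[OF s(1)[of "{Y<..}"] s(2)[of "{Y<..}"]]
    by (simp_all only: mult_minus_left lessThan_borel greaterThan_borel)
qed

context delta_shock_limit
begin

text \<open>The rescaled limit flux is affine on each side of the curve. Integration by parts
  returns \<open>vm\<close> and \<open>vp\<close> from the slopes, and the boundary terms add up to
  \<open>w0\<close>.\<close>

lemma flux0_integral:
  assumes "plane_test \<phi> \<phi>x \<phi>t t0 R" "t > 0"
  shows "scale t * (LBINT x. flux0 (x / scale t) * \<phi>x (x, t))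
    = vm * (LBINT x:{..<\<sigma> * scale t}. \<phi> (x, t)) + vp * (LBINT x:{\<sigma> * scale t<..}. \<phi> (x, t))
      + w0 * (scale t * \<phi> (\<sigma> * scale t, t))"
proof -
  interpret plane_test \<phi> \<phi>x \<phi>t t0 R by fact
  define s where "s = scale t"
  define X where "X = \<sigma> * s"
  have s: "s > 0" using scale_pos[OF assms(2)] by (simp add: s_def)
  define h where "h C x = (C - x) * \<phi>x (x, t)" for C x
  have less: "x / s < \<sigma> \<longleftrightarrow> x < X" for x using s by (simp add: X_def field_simps)
  have i: "integrable lborel (\<lambda>x. indicator S x * h C x)" if "S \<in> sets borel" for S C
    using integrable_mult_indicator[of S lborel "h C"] half_line_affine(3)[of C t] that by (simp add: h_def[abs_def])
  have "s * (LBINT x. flux0 (x / s) * \<phi>x (x, t)) = (LBINT x. s * (flux0 (x / s) * \<phi>x (x, t)))" by simp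
  also have "\<dots> = (LBINT x. vm * (indicator {..<X} x * h (um ^ k * s) x) + vp * (indicator {X<..} x * h (up ^ k * s) x))"
  proof (rule integral_cong_AE)
    have [measurable]: "(\<lambda>x. \<phi>x (x, t)) \<in> borel_measurable borel"
      by (intro borel_measurable_continuous_onI continuous_section)
    show "(\<lambda>x. s * (flux0 (x / s) * \<phi>x (x, t))) \<in> borel_measurable lborel"
      unfolding flux0_def by measurable
    show "(\<lambda>x. vm * (indicator {..<X} x * h (um ^ k * s) x) + vp * (indicator {X<..} x * h (up ^ k * s) x))
        \<in> borel_measurable lborel"
      unfolding h_def by measurable
    show "AE x in lborel. s * (flux0 (x / s) * \<phi>x (x, t))
      = vm * (indicator {..<X} x * h (um ^ k * s) x) + vp * (indicator {X<..} x * h (up ^ k * s) x)"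
      using AE_lborel_singleton[of X]
    proof eventually_elim
      case (elim x)
      have "s * flux0 (x / s) = (if x < X then vm * (um ^ k * s - x) else vp * (up ^ k * s - x))"
        using s by (simp add: flux0_def less field_simps)
      then show ?case using elim
        by (simp add: h_def indicator_def flip: mult.assoc)
    qed
  qed
  also have "\<dots> = vm * (LBINT x:{..<X}. h (um ^ k * s) x) + vp * (LBINT x:{X<..}. h (up ^ k * s) x)"
    using i by (simp add: set_lebesgue_integral_def)
  also have "\<dots> = vm * ((um ^ k * s - X) * \<phi> (X, t) + (LBINT x:{..<X}. \<phi> (x, t)))
      + vp * (- (up ^ k * s - X) * \<phi> (X, t) + (LBINT x:{X<..}. \<phi> (x, t)))"
    unfolding h_def half_line_affine ..
  also have "\<dots> = vm * (LBINT x:{..<X}. \<phi> (x, t)) + vp * (LBINT x:{X<..}. \<phi> (x, t)) + w0 * (s * \<phi> (X, t))"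
  proof -
    have w0: "w0 = - \<sigma> * (vm - vp) + (vm * um ^ k - vp * up ^ k)"
      using constants by (simp add: delta_shock_constants_def)
    show ?thesis unfolding w0 X_def by (simp add: algebra_simps)
  qed
  finally show ?thesis by (simp add: X_def s_def)
qed

text \<open>Pointwise limits of the density would miss the Dirac mass. Integration by parts in
  \<open>x\<close> passes to the flux, which converges boundedly, and dominated convergence then
  applies first in \<open>x\<close> and afterwards in \<open>t\<close>.\<close>

lemma v_converges:
  assumes "plane_test \<phi> \<phi>x \<phi>t t0 R"
  shows "((\<lambda>\<epsilon>. LBINT t:{0<..}. (LBINT x. similarity_solution \<alpha> k (v \<epsilon>) x t * \<phi> (x, t)))
    \<longlongrightarrow> pairing W (\<lambda>_. 1) \<phi>) (at_right 0)"
proof (rule tendsto_at_right_sequentially[of 0 1])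
  interpret plane_test \<phi> \<phi>x \<phi>t t0 R by fact
  \<comment> \<open>On the support \<bar>x\<bar> \<le> R and t \<ge> t0, so the similarity variable
    stays between \<open>- L\<close> and \<open>L\<close>.\<close>
  define L where "L = R / scale t0"
  obtain B where B: "B > 0" "eventually (\<lambda>\<epsilon>. \<forall>x. \<bar>x\<bar> \<le> L \<longrightarrow> \<bar>flux \<epsilon> x\<bar> \<le> B) (at_right 0)"
    by (rule flux_bounded)
  obtain D where D: "D > 0" "\<And>p. \<bar>\<phi>x p\<bar> \<le> D" using bound by metis
  have van: "\<phi> (x, t) = 0 \<and> \<phi>x (x, t) = 0" if "x \<notin> {-R..R} \<or> t \<notin> {t0..R}" for x t
    using vanish[OF that] by blast
  fix S :: "nat \<Rightarrow> real" assume S: "\<And>n. 0 < S n" "S \<longlonglongrightarrow> 0"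
  have "S n \<noteq> 0" for n using S(1)[of n] by simp
  with S have lim: "filterlim S (at_right 0) sequentially" by (auto simp: filterlim_at)
  from B(2) lim have "eventually (\<lambda>n. \<forall>x. \<bar>x\<bar> \<le> L \<longrightarrow> \<bar>flux (S n) x\<bar> \<le> B) sequentially"
    by (rule eventually_compose_filterlim)
  then obtain N where N: "\<And>n x. n \<ge> N \<Longrightarrow> \<bar>x\<bar> \<le> L \<Longrightarrow> \<bar>flux (S n) x\<bar> \<le> B"
    unfolding eventually_sequentially by blast
  \<comment> \<open>Dropping the first \<open>N\<close> terms makes the flux bound hold for every
    \<open>n\<close>; the offset is removed at the end.\<close>
  define T where "T n = S (n + N)" for n
  have T: "T n > 0" for n using S by (simp add: T_def)
  have TB: "\<bar>flux (T n) x\<bar> \<le> B" if "\<bar>x\<bar> \<le> L" for n x using N that by (simp add: T_def)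
  have limT: "filterlim T (at_right 0) sequentially"
    unfolding T_def using filterlim_compose[OF lim filterlim_add_const_nat_at_top] .
  have P: "viscous_profile k (T n) vm um vp up (v (T n)) (u (T n))" for n
    by (rule viscous_profileI[OF T])
  define \<Phi> where "\<Phi> n t = (LBINT x. similarity_solution \<alpha> k (v (T n)) x t * \<phi> (x, t))" for n t
  define \<Phi>0 where "\<Phi>0 t = vm * (LBINT x:{..<\<sigma> * scale t}. \<phi> (x, t)) + vp * (LBINT x:{\<sigma> * scale t<..}. \<phi> (x, t))
      + w0 * (scale t * \<phi> (\<sigma> * scale t, t))" for t
  have out: "\<Phi> n t = 0 \<and> \<Phi>0 t = 0" if "t \<notin> {t0..R}" for n t
    using van that by (simp add: \<Phi>_def \<Phi>0_def set_lebesgue_integral_def)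
  have \<Phi>: "\<Phi> n t = scale t * (LBINT x. flux (T n) (x / scale t) * \<phi>x (x, t))" if "t > 0" for n t
    unfolding \<Phi>_def similarity_solution_def similarity_variable_eq[OF that]
    by (rule viscous_profile.integral_by_parts[OF P scale_pos[OF that] DERIV_x continuous_section(2)]) (use van in blast)
  have flux_le: "\<bar>flux (T n) (x / scale t) * \<phi>x (x, t)\<bar> \<le> B * D * indicator {-R..R} x" if "t \<ge> t0" for n t x
  proof (cases "x \<in> {-R..R}")
    case True
    have "0 < scale t0" "scale t0 \<le> scale t" using scale_pos[OF t0_pos] scale_mono[OF that] by auto
    then have "\<bar>x / scale t\<bar> \<le> L"
      unfolding L_def abs_divide using True R_pos by (intro frac_le) auto
    then have "\<bar>flux (T n) (x / scale t)\<bar> * \<bar>\<phi>x (x, t)\<bar> \<le> B * D"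
      using TB D(2) B by (intro mult_mono) auto
    then show ?thesis using True by (simp add: abs_mult)
  next
    case False
    then show ?thesis using van by simp
  qed
  have intw: "integrable lborel (\<lambda>x::real. c * indicator {a..b} x)" for a b c :: real
    by (intro integrable_mult_right integrable_real_indicator) (auto simp: emeasure_lborel_Icc_eq)
  have mf: "(\<lambda>x. flux (T n) (x / scale t) * \<phi>x (x, t)) \<in> borel_measurable lborel" if "t > 0" for n t
  proof -
    have "continuous_on UNIV (\<lambda>x. flux (T n) (x / scale t))"
      using scale_pos[OF that]
      by (intro continuous_on_compose2[OF viscous_profile.continuous_flux[OF P, of UNIV]] continuous_intros) auto
    then have "continuous_on UNIV (\<lambda>x. flux (T n) (x / scale t) * \<phi>x (x, t))"
      by (intro continuous_intros continuous_section)
    from borel_measurable_continuous_onI[OF this] show ?thesis by simp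
  qed
  have lim\<Phi>: "(\<lambda>n. \<Phi> n t) \<longlonglongrightarrow> \<Phi>0 t" for t
  proof (cases "t \<in> {t0..R}")
    case True
    then have t: "t > 0" "t \<ge> t0" using t0_pos by auto
    note sp = scale_pos[OF t(1)]
    have "(\<lambda>n. LBINT x. flux (T n) (x / scale t) * \<phi>x (x, t)) \<longlonglongrightarrow> (LBINT x. flux0 (x / scale t) * \<phi>x (x, t))"
    proof (rule integral_dominated_convergence[where w = "\<lambda>x. B * D * indicator {-R..R} x"])
      have [measurable]: "(\<lambda>x. \<phi>x (x, t)) \<in> borel_measurable borel"
        by (intro borel_measurable_continuous_onI continuous_section)
      show "(\<lambda>x. flux0 (x / scale t) * \<phi>x (x, t)) \<in> borel_measurable lborel"
        unfolding flux0_def by measurable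
      show "AE x in lborel. (\<lambda>n. flux (T n) (x / scale t) * \<phi>x (x, t)) \<longlonglongrightarrow> flux0 (x / scale t) * \<phi>x (x, t)"
        using AE_lborel_singleton[of "\<sigma> * scale t"]
      proof eventually_elim
        case (elim x)
        then have "x / scale t \<noteq> \<sigma>" using sp by auto
        then have "((\<lambda>\<epsilon>. flux \<epsilon> (x / scale t)) \<longlongrightarrow> flux0 (x / scale t)) (at_right 0)"
          using limits_left(2) limits_right(2) by (metis linorder_neqE_linordered_idom)
        from filterlim_compose[OF this limT] show ?case by (intro tendsto_intros)
      qed
    qed (use mf[OF t(1)] intw flux_le[OF t(2)] in auto)
    from tendsto_mult_left[OF this, of "scale t"] show ?thesis
      unfolding \<Phi>[OF t(1)] \<Phi>0_def flux0_integral[OF assms t(1)] .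
  qed (use out in simp)
  have [measurable]: "\<phi> \<in> borel_measurable (borel \<Otimes>\<^sub>M borel)"
    unfolding borel_prod using cont(1) by (rule borel_measurable_continuous_onI)
  have m\<Phi>: "\<Phi> n \<in> borel_measurable borel" for n
  proof -
    have [measurable]: "v (T n) \<in> borel_measurable borel" by (rule viscous_profile.v_measurable[OF P])
    show ?thesis
      unfolding \<Phi>_def[abs_def] similarity_solution_def similarity_variable_def by measurable
  qed
  have le_norm: "norm a \<le> norm b" if "\<bar>a\<bar> \<le> b" for a b :: real using that by simp
  have dom: "\<bar>\<Phi> n t\<bar> \<le> (scale R * (B * D * (2 * R))) * indicator {t0..R} t" for n t
  proof (cases "t \<in> {t0..R}")
    case True
    then have t: "t > 0" "t \<ge> t0" "t \<le> R" using t0_pos by auto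
    have "norm (LBINT x. flux (T n) (x / scale t) * \<phi>x (x, t)) \<le> (LBINT x. B * D * indicator {-R..R} x)"
    proof (rule Bochner_Integration.integral_norm_bound_integral[OF _ intw])
      show "integrable lborel (\<lambda>x. flux (T n) (x / scale t) * \<phi>x (x, t))"
        by (rule Bochner_Integration.integrable_bound[OF intw[of "B * D" "- R" R] mf[OF t(1)]])
          (intro AE_I2 le_norm flux_le[OF t(2)])
    qed (use flux_le[OF t(2)] in simp)
    also have "\<dots> = B * D * (2 * R)" using R_pos by simp
    finally have "\<bar>LBINT x. flux (T n) (x / scale t) * \<phi>x (x, t)\<bar> \<le> B * D * (2 * R)" by simp
    then have "scale t * \<bar>LBINT x. flux (T n) (x / scale t) * \<phi>x (x, t)\<bar> \<le> scale R * (B * D * (2 * R))"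
      using scale_pos[OF t(1)] scale_mono[OF t(3)] by (intro mult_mono) auto
    then show ?thesis using True scale_pos[OF t(1)] by (simp add: \<Phi>[OF t(1)] abs_mult)
  qed (use out in simp)
  have m\<Phi>0: "\<Phi>0 \<in> borel_measurable borel"
    by (rule borel_measurable_LIMSEQ_real[OF lim\<Phi> m\<Phi>])
  have main: "(\<lambda>n. LBINT t. \<Phi> n t) \<longlonglongrightarrow> (LBINT t. \<Phi>0 t)"
    by (rule integral_dominated_convergence[OF _ _ intw[of "scale R * (B * D * (2 * R))" t0 R]]) (use m\<Phi> m\<Phi>0 lim\<Phi> dom in auto)
  have "pairing W (\<lambda>_. 1) \<phi> = (LBINT t. \<Phi>0 t)"
  proof -
    have ic: "integrable lborel (\<lambda>t. scale t * \<phi> (\<sigma> * scale t, t))"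
      by (intro integrable_curve continuous_intros continuous_scale)
    \<comment> \<open>The limit inherits the bound of the sequence. Its integrability lets the Dirac
      term be split off, because \<open>pairing\<close> integrates the two parts separately.\<close>
    have i0: "integrable lborel \<Phi>0"
    proof (rule Bochner_Integration.integrable_bound[OF intw])
      show "\<Phi>0 \<in> borel_measurable lborel" using m\<Phi>0 by simp
      have "\<bar>\<Phi>0 t\<bar> \<le> (scale R * (B * D * (2 * R))) * indicator {t0..R} t" for t
        by (rule LIMSEQ_le_const2[OF tendsto_rabs[OF lim\<Phi>]]) (use dom in auto)
      then show "AE t in lborel. norm (\<Phi>0 t) \<le> norm ((scale R * (B * D * (2 * R))) * indicator {t0..R} t)"
        by (intro AE_I2 le_norm)
    qed
    have "pairing W (\<lambda>_. 1) \<phi>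
      = (LBINT t. \<Phi>0 t - w0 * (scale t * \<phi> (\<sigma> * scale t, t))) + (LBINT t. w0 * (scale t * \<phi> (\<sigma> * scale t, t)))"
      using pairing_eq[of \<phi> "\<lambda>_. 1"] integrable_section van t0_pos by (simp add: \<Phi>0_def)
    then show ?thesis using i0 ic by simp
  qed
  moreover have "(LBINT t:{0<..}. (LBINT x. similarity_solution \<alpha> k (v (T n)) x t * \<phi> (x, t))) = (LBINT t. \<Phi> n t)" for n
    unfolding \<Phi>_def by (rule set_integral_eq_integral) (use van t0_pos in simp)
  ultimately have "(\<lambda>n. LBINT t:{0<..}. (LBINT x. similarity_solution \<alpha> k (v (S (n + N))) x t * \<phi> (x, t)))
      \<longlonglongrightarrow> pairing W (\<lambda>_. 1) \<phi>"
    using main by (simp add: T_def)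
  then show "(\<lambda>n. LBINT t:{0<..}. (LBINT x. similarity_solution \<alpha> k (v (S n)) x t * \<phi> (x, t)))
      \<longlonglongrightarrow> pairing W (\<lambda>_. 1) \<phi>"
    by (rule LIMSEQ_offset)
qed simp

lemma converges: "converges_in_measure_sense \<alpha> k v u W"
  unfolding converges_in_measure_sense_def
proof (intro conjI allI impI)
  fix t x :: real assume t: "t > 0" and x: "x \<noteq> curve W t"
  have s: "scale t > 0" using scale_pos[OF t] .
  have cmp: "x / scale t < \<sigma> \<longleftrightarrow> x < \<sigma> * scale t" "x / scale t = \<sigma> \<longleftrightarrow> x = \<sigma> * scale t"
    using s by (auto simp: field_simps)
  show "((\<lambda>\<epsilon>. similarity_solution \<alpha> k (u \<epsilon>) x t) \<longlongrightarrow> velocity W x t) (at_right 0)"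
  proof (cases "x / scale t < \<sigma>")
    case True
    then show ?thesis using limits_left(1)[OF True] cmp
      by (simp add: similarity_solution_def similarity_variable_eq[OF t] W_simps)
  next
    case False
    then have "x / scale t > \<sigma>" using x cmp(2) by (simp add: W_simps)
    from limits_right(1)[OF this] False x cmp show ?thesis
      by (simp add: similarity_solution_def similarity_variable_eq[OF t] W_simps)
  qed
next
  fix t :: real
  have "eventually (\<lambda>\<epsilon>. u \<epsilon> (z \<epsilon>) = u \<epsilon> (xi_sigma k (u \<epsilon>))) (at_right 0)"
    by (rule eventually_profile) (simp add: viscous_profile.z_def)
  from Lim_transform_eventually[OF u_z_tendsto this]
  show "((\<lambda>\<epsilon>. u \<epsilon> (xi_sigma k (u \<epsilon>))) \<longlongrightarrow> velocity W (curve W t) t) (at_right 0)"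
    by (simp add: W_simps)
next
  fix \<phi> :: "real \<times> real \<Rightarrow> real" assume "test_function half_plane \<phi>"
  then obtain t0 R where "plane_test \<phi> (deriv_x \<phi>) (deriv_t \<phi>) t0 R" by (rule test_function_half_plane)
  then show "((\<lambda>\<epsilon>. LBINT t:{0<..}. (LBINT x. similarity_solution \<alpha> k (v \<epsilon>) x t * \<phi> (x, t)))
    \<longlongrightarrow> pairing W (\<lambda>_. 1) \<phi>) (at_right 0)" by (rule v_converges)
qed

end

theorem theorem3p2:
  fixes k :: nat and \<alpha> vm vp um up :: real
    and v u :: "real \<Rightarrow> real \<Rightarrow> real"
  assumes "odd k" and "\<alpha> > 0" and "vm > 0" and "vp > 0" and "um > up"
    and "\<And>\<epsilon>. \<epsilon> > 0 \<Longrightarrow> similarity_profile k \<epsilon> vm um vp up (v \<epsilon>) (u \<epsilon>)"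
  shows "\<exists>\<sigma> w0 ud.
     delta_shock_constants k vm um vp up \<sigma> w0 ud \<and>
     (\<forall>\<sigma>' w0' ud'. delta_shock_constants k vm um vp up \<sigma>' w0' ud' \<longrightarrow>
        \<sigma>' = \<sigma> \<and> w0' = w0 \<and> ud' = ud) \<and>
     converges_in_measure_sense \<alpha> k v u (delta_shock \<alpha> k vm um vp up \<sigma> w0 ud) \<and>
     solves_limit_system \<alpha> k (delta_shock \<alpha> k vm um vp up \<sigma> w0 ud) \<and>
     attains_initial_data (delta_shock \<alpha> k vm um vp up \<sigma> w0 ud)
       (riemann_data vm vp) (riemann_data um up)"
proof -
  obtain ud where ud: "up < ud" "ud < um" "shock_defect k vm um vp up ud = 0"
    using shock_defect_root[OF assms(1,3,4,5)] .
  define \<sigma> where "\<sigma> = ud ^ k"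
  define w0 where "w0 = - \<sigma> * (vm - vp) + (vm * um ^ k - vp * up ^ k)"
  have c: "delta_shock_constants k vm um vp up \<sigma> w0 ud"
    unfolding delta_shock_constants_iff[OF assms(1)] using ud by (simp add: \<sigma>_def w0_def)
  interpret delta_shock_limit k vm um vp up v u \<alpha> \<sigma> w0 ud
    using assms c by unfold_locales (auto simp: odd_pos)
  have "\<sigma>' = \<sigma> \<and> w0' = w0 \<and> ud' = ud" if "delta_shock_constants k vm um vp up \<sigma>' w0' ud'" for \<sigma>' w0' ud'
  proof -
    note that = that[unfolded delta_shock_constants_iff[OF assms(1)]]
    \<comment> \<open>Two roots between the end states would contradict strict monotonicity of the
      defect; \<sigma> and \<open>w0\<close> are functions of the root.\<close>
    have "ud' = ud"
    proof (rule ccontr)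
      assume "ud' \<noteq> ud"
      then consider "ud' < ud" | "ud < ud'" by linarith
      then show False
        using shock_defect_strict_mono[OF assms(1,3,4), of up ud' ud um]
          shock_defect_strict_mono[OF assms(1,3,4), of up ud ud' um] that ud by cases auto
    qed
    then show ?thesis using that by (simp add: \<sigma>_def w0_def)
  qed
  with c converges solves[OF c] initial_data show ?thesis by blast
qed

end
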